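(* Let $\Theta\subsetneq\Pi$ be seminormal. Then for all $x,y\in W(\Theta)'$ one has $x\leqslant y$ if and only if $x\leqslant_\Theta y$, where $\leqslant$ is the Bruhat ordering of $W$ and $\leqslant_\Theta$ is the Bruhat ordering of the Coxeter system $(W(\Theta)',S(\Theta))$.
   Context: $\mathfrak g$ is a complex reductive Lie algebra with Cartan subalgebra $\mathfrak h$, root system $\Delta$, positive system $\Delta^+$, simple roots $\Pi$, Weyl group $W$ (Coxeter generators: the simple reflections), and $\langle\cdot,\cdot\rangle$ an invariant form on $\mathfrak h^*$. For $\Theta\subsetneq\Pi$: $\mathfrak a_\Theta=\{H\in\mathfrak h\mid\alpha(H)=0\ \forall\alpha\in\Theta\}$, with $\mathfrak a_\Theta^*$ viewed in $\mathfrak h^*$ as the orthogonal complement of $\Theta$; $W_\Theta$ is the subgroup generated by $s_\alpha$ ($\alpha\in\Theta$), with longest element $w_\Theta$. For $\alpha\in\Delta$ let $\Delta(\alpha)=\{\beta\in\Delta\mid\exists c\in\mathbb R:\ \beta|_{\mathfrak a_\Theta}=c\,\alpha|_{\mathfrak a_\Theta}\}$, $\Delta^+(\alpha)=\Delta(\alpha)\cap\Delta^+$ with simple roots $\Pi(\alpha)$, $W_\Theta(\alpha)$ the Weyl group of $\Delta(\alpha)$, $w^\alpha$ its longest element (with respect to $\Pi(\alpha)$), $\sigma_\alpha=w^\alpha w_\Theta$. $\alpha$ is $\Theta$-useful if $\sigma_\alpha$ has order two. If $\alpha|_{\mathfrak a_\Theta}\ne0$ then $\Pi(\alpha)=\Theta\cup\{\tilde\alpha\}$,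 and $\alpha$ is $\Theta$-reduced if $\alpha=\tilde\alpha$. ${}^{ru}\Delta^+_\Theta$ is the set of positive, $\Theta$-useful, $\Theta$-reduced roots, and $W(\Theta)'$ is the subgroup of $W$ generated by $\{\sigma_\alpha\mid\alpha\in{}^{ru}\Delta_\Theta^+\}$. Put ${}^{ru}\Sigma_\Theta^+=\{\alpha|_{\mathfrak a_\Theta}\mid\alpha\in{}^{ru}\Delta_\Theta^+\}$. It is known (Howlett, Lusztig) that ${}^{ru}\Sigma_\Theta={}^{ru}\Sigma^+_\Theta\cup-{}^{ru}\Sigma^+_\Theta$ is a reduced root system with positive system ${}^{ru}\Sigma_\Theta^+$; let ${}^u\Pi_\Theta$ be its simple roots. For $\gamma=\alpha|_{\mathfrak a_\Theta}\in{}^{ru}\Sigma^+_\Theta$ write $\sigma_\gamma=\sigma_\alpha$; it acts on $\mathfrak a_\Theta^*$ as the reflection in $\gamma$. With $S(\Theta)=\{\sigma_\gamma\mid\gamma\in{}^u\Pi_\Theta\}$, $(W(\Theta)',S(\Theta))$ is a Coxeter system (restriction to $\mathfrak a_\Theta^*$ identifies $W(\Theta)'$ with the Weyl group of ${}^{ru}\Sigma_\Theta$). $\Theta$ is called seminormal if there is $\Psi$ with $\Theta\subseteq\Psi\subseteq\Pi$ and ${}^u\Pi_\Theta=\{\alpha|_{\mathfrak a_\Theta}\mid\alpha\in\Psi-\Theta\}$. *)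

theory Defs
  imports
    "HOL-Analysis.Analysis"
    "HOL-Algebra.Bij"
    "HOL-Algebra.Generated_Groups"
    "HOL-Algebra.Multiplicative_Group"
begin

text \<open>
  The notions of length, longest element and Bruhat order below are applied to Coxeter systems
  \<open>(G, S)\<close> only; in that case all the elements of \<open>S\<close> are
  involutions, so words over \<open>S\<close> (without inverses) represent every element of \<open>G\<close>.
\<close>

definition word_length :: "('g, 'm) monoid_scheme \<Rightarrow> 'g set \<Rightarrow> 'g \<Rightarrow> nat" where
  "word_length G S w =
     (LEAST n. \<exists>ws. length ws = n \<and> set ws \<subseteq> S \<and> foldr (mult G) ws \<one>\<^bsub>G\<^esub> = w)"

definition longest_element :: "('g, 'm) monoid_scheme \<Rightarrow> 'g set \<Rightarrow> 'g" where
  "longest_element G S =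
     (THE w. w \<in> carrier G \<and> (\<forall>v\<in>carrier G. word_length G S v \<le> word_length G S w))"

definition coxeter_reflections :: "('g, 'm) monoid_scheme \<Rightarrow> 'g set \<Rightarrow> 'g set" where
  "coxeter_reflections G S = {w \<otimes>\<^bsub>G\<^esub> s \<otimes>\<^bsub>G\<^esub> inv\<^bsub>G\<^esub> w | w s. w \<in> carrier G \<and> s \<in> S}"

definition bruhat_step :: "('g, 'm) monoid_scheme \<Rightarrow> 'g set \<Rightarrow> 'g \<Rightarrow> 'g \<Rightarrow> bool" where
  "bruhat_step G S u v \<longleftrightarrow>
     u \<in> carrier G \<and> (\<exists>t\<in>coxeter_reflections G S. v = u \<otimes>\<^bsub>G\<^esub> t)
     \<and> word_length G S u < word_length G S v"

definition bruhat_le :: "('g, 'm) monoid_scheme \<Rightarrow> 'g set \<Rightarrow> 'g \<Rightarrow> 'g \<Rightarrow> bool" where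
  "bruhat_le G S = (bruhat_step G S)\<^sup>*\<^sup>*"

text \<open>
  The Euclidean space \<^typ>\<open>'a::euclidean_space\<close> is the real form of the dual of the Cartan
  subalgebra on which all roots of a complex reductive Lie algebra live, and the inner product is
  the restriction of an invariant form, positive definite on that real form. It is used to identify
  the real form of the Cartan subalgebra with its dual. The roots are not required to span, since
  a reductive Lie algebra may have a centre.
\<close>

definition root_refl :: "'a::euclidean_space \<Rightarrow> 'a \<Rightarrow> 'a" where
  "root_refl \<alpha> v = v - (2 * (v \<bullet> \<alpha>) / (\<alpha> \<bullet> \<alpha>)) *\<^sub>R \<alpha>"

definition root_system :: "'a::euclidean_space set \<Rightarrow> bool" where
  "root_system \<Delta> \<longleftrightarrow>
     finite \<Delta> \<and> 0 \<notin> \<Delta>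
     \<and> (\<forall>\<alpha>\<in>\<Delta>. root_refl \<alpha> ` \<Delta> = \<Delta>)
     \<and> (\<forall>\<alpha>\<in>\<Delta>. \<forall>\<beta>\<in>\<Delta>. 2 * (\<beta> \<bullet> \<alpha>) / (\<alpha> \<bullet> \<alpha>) \<in> \<int>)
     \<and> (\<forall>\<alpha>\<in>\<Delta>. \<forall>c. c *\<^sub>R \<alpha> \<in> \<Delta> \<longrightarrow> c = 1 \<or> c = -1)"

definition positive_system :: "'a::euclidean_space set \<Rightarrow> 'a set \<Rightarrow> bool" where
  "positive_system \<Delta> P \<longleftrightarrow>
     (\<exists>\<xi>. (\<forall>\<alpha>\<in>\<Delta>. \<alpha> \<bullet> \<xi> \<noteq> 0) \<and> P = {\<alpha> \<in> \<Delta>. \<alpha> \<bullet> \<xi> > 0})"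

text \<open>
  For a positive system of a crystallographic root system, the indecomposable elements form the
  base. The restricted roots in \<open>ru_Sigma_pos\<close> below are also such a system: the reflection in a
  restricted root changes any restricted root by an integer multiple of it, because \<open>sigma\<close> changes
  a root by an integer combination of \<open>\<Pi>(\<alpha>)\<close>.
\<close>

definition simple_roots :: "'a::euclidean_space set \<Rightarrow> 'a set" where
  "simple_roots P = {\<alpha> \<in> P. \<not> (\<exists>\<beta>\<in>P. \<exists>\<gamma>\<in>P. \<alpha> = \<beta> + \<gamma>)}"

definition weyl_group :: "'a::euclidean_space set \<Rightarrow> ('a \<Rightarrow> 'a) monoid" where
  "weyl_group R = (BijGroup UNIV)\<lparr>carrier := generate (BijGroup UNIV) (root_refl ` R)\<rparr>"

text \<open>
  In what follows \<open>\<Delta>\<close> is the root system, \<open>P\<close> the positive system and \<open>\<Theta>\<close> a set of simple roots.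
  Under the identification by the inner product, \<open>\<aa>\<^sub>\<Theta>\<close> and its dual are the same subspace.
\<close>

definition aa :: "'a::euclidean_space set \<Rightarrow> 'a set" where
  "aa \<Theta> = {H. \<forall>\<alpha>\<in>\<Theta>. \<alpha> \<bullet> H = 0}"

text \<open>\<open>res \<Theta> \<alpha>\<close> is the functional \<open>H \<mapsto> \<alpha>(H)\<close> on \<open>\<aa>\<^sub>\<Theta>\<close>, viewed as a vector orthogonal to \<open>\<Theta>\<close>.\<close>

definition res :: "'a::euclidean_space set \<Rightarrow> 'a \<Rightarrow> 'a" where
  "res \<Theta> \<alpha> = (THE v. v \<in> aa \<Theta> \<and> (\<forall>H\<in>aa \<Theta>. v \<bullet> H = \<alpha> \<bullet> H))"

definition Delta_at :: "'a::euclidean_space set \<Rightarrow> 'a set \<Rightarrow> 'a \<Rightarrow> 'a set" where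
  "Delta_at \<Delta> \<Theta> \<alpha> = {\<beta> \<in> \<Delta>. \<exists>c. res \<Theta> \<beta> = c *\<^sub>R res \<Theta> \<alpha>}"

definition Pi_at :: "'a::euclidean_space set \<Rightarrow> 'a set \<Rightarrow> 'a set \<Rightarrow> 'a \<Rightarrow> 'a set" where
  "Pi_at \<Delta> P \<Theta> \<alpha> = simple_roots (Delta_at \<Delta> \<Theta> \<alpha> \<inter> P)"

definition sigma :: "'a::euclidean_space set \<Rightarrow> 'a set \<Rightarrow> 'a set \<Rightarrow> 'a \<Rightarrow> ('a \<Rightarrow> 'a)" where
  "sigma \<Delta> P \<Theta> \<alpha> =
     longest_element (weyl_group (Delta_at \<Delta> \<Theta> \<alpha>)) (root_refl ` Pi_at \<Delta> P \<Theta> \<alpha>)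
     \<otimes>\<^bsub>weyl_group \<Delta>\<^esub> longest_element (weyl_group \<Theta>) (root_refl ` \<Theta>)"

definition useful :: "'a::euclidean_space set \<Rightarrow> 'a set \<Rightarrow> 'a set \<Rightarrow> 'a \<Rightarrow> bool" where
  "useful \<Delta> P \<Theta> \<alpha> \<longleftrightarrow> group.ord (weyl_group \<Delta>) (sigma \<Delta> P \<Theta> \<alpha>) = 2"

text \<open>If \<open>\<alpha>\<close> does not vanish on \<open>\<aa>\<^sub>\<Theta>\<close>, then \<open>\<Pi>(\<alpha>)\<close> has exactly one element outside \<open>\<Theta>\<close>.\<close>

definition tilde :: "'a::euclidean_space set \<Rightarrow> 'a set \<Rightarrow> 'a set \<Rightarrow> 'a \<Rightarrow> 'a" where
  "tilde \<Delta> P \<Theta> \<alpha> = (THE \<beta>. \<beta> \<notin> \<Theta> \<and> Pi_at \<Delta> P \<Theta> \<alpha> = \<Theta> \<union> {\<beta>})"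

definition reduced :: "'a::euclidean_space set \<Rightarrow> 'a set \<Rightarrow> 'a set \<Rightarrow> 'a \<Rightarrow> bool" where
  "reduced \<Delta> P \<Theta> \<alpha> \<longleftrightarrow> res \<Theta> \<alpha> \<noteq> 0 \<and> \<alpha> = tilde \<Delta> P \<Theta> \<alpha>"

definition ru_Delta_pos :: "'a::euclidean_space set \<Rightarrow> 'a set \<Rightarrow> 'a set \<Rightarrow> 'a set" where
  "ru_Delta_pos \<Delta> P \<Theta> = {\<alpha> \<in> P. useful \<Delta> P \<Theta> \<alpha> \<and> reduced \<Delta> P \<Theta> \<alpha>}"

definition ru_Sigma_pos :: "'a::euclidean_space set \<Rightarrow> 'a set \<Rightarrow> 'a set \<Rightarrow> 'a set" where
  "ru_Sigma_pos \<Delta> P \<Theta> = res \<Theta> ` ru_Delta_pos \<Delta> P \<Theta>"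

definition u_Pi :: "'a::euclidean_space set \<Rightarrow> 'a set \<Rightarrow> 'a set \<Rightarrow> 'a set" where
  "u_Pi \<Delta> P \<Theta> = simple_roots (ru_Sigma_pos \<Delta> P \<Theta>)"

definition W_prime :: "'a::euclidean_space set \<Rightarrow> 'a set \<Rightarrow> 'a set \<Rightarrow> ('a \<Rightarrow> 'a) monoid" where
  "W_prime \<Delta> P \<Theta> = (weyl_group \<Delta>)
     \<lparr>carrier := generate (weyl_group \<Delta>) (sigma \<Delta> P \<Theta> ` ru_Delta_pos \<Delta> P \<Theta>)\<rparr>"

text \<open>\<open>sigma \<Delta> P \<Theta> \<alpha>\<close> depends on \<open>\<alpha>\<close> only through \<open>res \<Theta> \<alpha>\<close>, as \<^const>\<open>Delta_at\<close> does.\<close>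

definition S_Theta :: "'a::euclidean_space set \<Rightarrow> 'a set \<Rightarrow> 'a set \<Rightarrow> ('a \<Rightarrow> 'a) set" where
  "S_Theta \<Delta> P \<Theta> = {sigma \<Delta> P \<Theta> \<alpha> | \<alpha>. \<alpha> \<in> ru_Delta_pos \<Delta> P \<Theta> \<and> res \<Theta> \<alpha> \<in> u_Pi \<Delta> P \<Theta>}"

definition seminormal :: "'a::euclidean_space set \<Rightarrow> 'a set \<Rightarrow> 'a set \<Rightarrow> bool" where
  "seminormal \<Delta> P \<Theta> \<longleftrightarrow>
     (\<exists>\<Psi>. \<Theta> \<subseteq> \<Psi> \<and> \<Psi> \<subseteq> simple_roots P \<and> u_Pi \<Delta> P \<Theta> = res \<Theta> ` (\<Psi> - \<Theta>))"

end

(*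
Every element of W(Theta)' permutes Theta, so it commutes with the restriction to aa Theta, and
restriction identifies W(Theta)' with the Weyl group of the restricted roots (an element acting
trivially on aa Theta preserves P). The sign of a root that does not vanish on aa Theta is the sign
of its restriction. In a Weyl group, u s_a > u exactly when u maps the positive root a to a positive
root.

If x sends the restricted root of alpha to a positive one, then x sends all positive roots of
Delta(alpha) to positive roots, hence x <= x u for all u in W_Theta(alpha), in particular for
u = sigma_alpha. So each step of the order of W(Theta)' is a relation in W.

Conversely, argue by induction on the length of y in W(Theta)'. Choose a simple reflection
sigma = sigma_alpha with y sigma shorter; by seminormality alpha is a simple root, so Theta with
alpha generates a standard parabolic subgroup, and y sigma as well as one of x, x sigma are
shortest in their cosets of it. Projection to shortest coset representatives preserves the Bruhat
order of W, and the lifting property in W(Theta)' brings the resulting relation back to x and y.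
*)
theory Submission
  imports Defs
begin

section \<open>Reflections and Weyl groups\<close>

text \<open>The obstacle is that a generator \<open>sigma\<close> of the small group is in general a
  long product of simple reflections of \<open>W\<close>, so lengths in the two groups do not
  compare directly and lifting in \<open>W\<close> says nothing about a single \<open>sigma\<close>
  step. Two devices get around this. The length condition of a Bruhat step is replaced by the sign
  of one root; signs, unlike lengths, pass through restriction. And a \<open>sigma\<close> step is
  resolved inside a subsystem, one reflection at a time. Going up uses only that reflections of the
  subsystem are reflections of \<open>W\<close>. Going down uses lifting in \<open>W\<close>, so the
  base of the subsystem has to consist of simple roots of \<open>P\<close>; this is where
  seminormality enters. All Coxeter theory is derived in one locale from the geometry of roots and
  used four times: for the whole system, for its parts in \<open>span \<Theta>\<close> and in
  \<open>line \<alpha>\<close>, and for the restricted roots. That the latter form a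
  crystallographic root system is proved on the way; integrality comes from the fact that
  restriction kills all of \<Pi>(\<alpha>) except \<alpha>.\<close>

lemma root_refl_linear: "linear (root_refl a)"
  by (rule linearI) (simp_all add: root_refl_def inner_add_left algebra_simps add_divide_distrib)

text \<open>\<open>root_refl 0\<close> is the identity, which is why identities for all
  \<open>a\<close> split off the case \<open>a = 0\<close>.\<close>

lemma root_refl_self [simp]: "root_refl a a = - a"
  by (cases "a = 0") (simp_all add: root_refl_def scaleR_2)

lemma root_refl_minus [simp]: "root_refl (- a) = root_refl a"
  by (rule ext) (simp add: root_refl_def)

lemma root_refl_root_refl [simp]: "root_refl a (root_refl a v) = v"
  by (cases "a = 0") (simp_all add: root_refl_def algebra_simps)

lemma root_refl_comp_self [simp]: "root_refl a \<circ> root_refl a = id"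
  by (rule ext) simp

lemma comp_root_refl_cancel [simp]: "f \<circ> root_refl a \<circ> root_refl a = f"
  by (rule ext) simp

lemma root_refl_inner [simp]: "root_refl a v \<bullet> root_refl a w = v \<bullet> w"
  by (cases "a = 0") (simp_all add: root_refl_def algebra_simps inner_commute)

lemma root_refl_orthogonal: "v \<bullet> a = 0 \<Longrightarrow> root_refl a v = v"
  by (simp add: root_refl_def)

lemma root_refl_conj:
  assumes "linear f" "\<And>v w. f v \<bullet> f w = v \<bullet> w"
  shows "f (root_refl a v) = root_refl (f a) (f v)"
  using assms by (simp add: root_refl_def linear_diff linear_cmul)

text \<open>Words are lists of vectors instead of lists of maps, so that an exchange argument can
  compare a letter with the image of a root.\<close>

definition refl_prod :: "'a::euclidean_space list \<Rightarrow> 'a \<Rightarrow> 'a" where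
  "refl_prod as = foldr (\<lambda>a f. root_refl a \<circ> f) as id"

lemma refl_prod_Nil [simp]: "refl_prod [] = id"
  by (simp add: refl_prod_def)

lemma refl_prod_Cons [simp]: "refl_prod (a # as) = root_refl a \<circ> refl_prod as"
  by (simp add: refl_prod_def)

lemma refl_prod_append [simp]: "refl_prod (as @ bs) = refl_prod as \<circ> refl_prod bs"
  by (induction as) auto

lemma refl_prod_rev: "refl_prod (rev as) \<circ> refl_prod as = id"
proof (induction as)
  case (Cons a as)
  have "refl_prod (rev (a # as)) \<circ> refl_prod (a # as)
      = refl_prod (rev as) \<circ> (root_refl a \<circ> root_refl a) \<circ> refl_prod as"
    by (simp add: comp_assoc del: root_refl_comp_self)
  then show ?case using Cons by simp
qed simp

lemma refl_prod_rev': "refl_prod as \<circ> refl_prod (rev as) = id"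
  using refl_prod_rev[of "rev as"] by simp

lemma refl_prod_linear: "linear (refl_prod as)"
  by (induction as) (simp_all add: linear_ident linear_compose root_refl_linear del: o_apply)

lemma refl_prod_inner: "refl_prod as v \<bullet> refl_prod as w = v \<bullet> w"
  by (induction as) auto

lemma refl_prod_bij: "bij (refl_prod as)"
  using refl_prod_rev refl_prod_rev' o_bij by blast

section \<open>Weyl groups as words in reflections\<close>

lemma BijGroup_UNIV:
  "carrier (BijGroup UNIV) = {f. bij f}"
  "\<one>\<^bsub>BijGroup UNIV\<^esub> = id"
  "bij f \<Longrightarrow> bij g \<Longrightarrow> f \<otimes>\<^bsub>BijGroup UNIV\<^esub> g = f \<circ> g"
  by (auto simp: BijGroup_def Bij_def compose_def extensional_def fun_eq_iff)

lemma BijGroup_UNIV_inv: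
  assumes "bij f" "g \<circ> f = id"
  shows "inv\<^bsub>BijGroup UNIV\<^esub> f = g"
proof -
  interpret group "BijGroup UNIV" by (rule group_BijGroup)
  have "bij g" using assms by (metis bij_betw_comp_iff bij_id)
  with assms show ?thesis
    by (intro inv_equality) (auto simp: BijGroup_UNIV)
qed

lemma bij_root_refl: "bij (root_refl a)"
  using refl_prod_bij[of "[a]"] by simp

text \<open>Reflections are involutions, so words without inverses exhaust the group. Plain sets of
  maps can be compared for different sets of roots.\<close>

definition weyl :: "'a::euclidean_space set \<Rightarrow> ('a \<Rightarrow> 'a) set" where
  "weyl R = {refl_prod as | as. set as \<subseteq> R}"

lemma carrier_weyl_group: "carrier (weyl_group R) = weyl R"
proof -
  have "generate (BijGroup UNIV) (root_refl ` R) = weyl R"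
  proof (intro equalityI subsetI)
    fix f assume "f \<in> generate (BijGroup UNIV) (root_refl ` R)"
    then show "f \<in> weyl R"
    proof induction
      case one
      have "id = refl_prod []" by simp
      then show ?case unfolding weyl_def BijGroup_UNIV by (metis (mono_tags, lifting) empty_set empty_subsetI mem_Collect_eq)
    next
      case (incl h)
      then obtain a where "a \<in> R" "h = root_refl a" by blast
      then show ?case unfolding weyl_def by (auto intro!: exI[of _ "[a]"])
    next
      case (inv h)
      then obtain a where a: "a \<in> R" "h = root_refl a" by blast
      then have "inv\<^bsub>BijGroup UNIV\<^esub> h = root_refl a"
        by (auto intro!: BijGroup_UNIV_inv bij_root_refl)
      with a show ?case unfolding weyl_def by (auto intro!: exI[of _ "[a]"])
    next
      case (eng h1 h2)
      then obtain as bs where "set as \<subseteq> R" "h1 = refl_prod as" "set bs \<subseteq> R" "h2 = refl_prod bs"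
        unfolding weyl_def by blast
      then show ?case unfolding weyl_def
        by (auto simp: BijGroup_UNIV refl_prod_bij intro!: exI[of _ "as @ bs"])
    qed
  next
    fix f assume "f \<in> weyl R"
    then obtain as where "set as \<subseteq> R" "f = refl_prod as" unfolding weyl_def by blast
    then show "f \<in> generate (BijGroup UNIV) (root_refl ` R)"
    proof (induction as arbitrary: f)
      case Nil
      then show ?case using generate.one[of "BijGroup UNIV"] by (metis BijGroup_UNIV(2) refl_prod_Nil)
    next
      case (Cons a as)
      then have "root_refl a \<otimes>\<^bsub>BijGroup UNIV\<^esub> refl_prod as \<in> generate (BijGroup UNIV) (root_refl ` R)"
        by (intro generate.eng) (auto intro: generate.incl)
      with Cons show ?case by (metis BijGroup_UNIV(3) bij_root_refl refl_prod_bij refl_prod_Cons)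
    qed
  qed
  then show ?thesis by (simp add: weyl_group_def)
qed

lemma group_weyl_group: "group (weyl_group R)"
proof -
  interpret group "BijGroup UNIV" by (rule group_BijGroup)
  show ?thesis unfolding weyl_group_def
    by (intro subgroup_imp_group generate_is_subgroup) (auto simp: BijGroup_UNIV bij_root_refl)
qed

lemma weyl_linear: "w \<in> weyl R \<Longrightarrow> linear w"
  by (auto simp: weyl_def refl_prod_linear)

lemma weyl_inner: "w \<in> weyl R \<Longrightarrow> w u \<bullet> w v = u \<bullet> v"
  by (auto simp: weyl_def refl_prod_inner)

lemma weyl_bij: "w \<in> weyl R \<Longrightarrow> bij w"
  by (auto simp: weyl_def refl_prod_bij)

lemma weyl_mono: "R \<subseteq> R' \<Longrightarrow> weyl R \<subseteq> weyl R'"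
  unfolding weyl_def by blast

lemma id_in_weyl [simp]: "id \<in> weyl R"
  unfolding weyl_def by (auto intro!: exI[of _ "[]"])

lemma root_refl_in_weyl: "a \<in> R \<Longrightarrow> root_refl a \<in> weyl R"
  unfolding weyl_def by (auto intro!: exI[of _ "[a]"])

lemma weyl_comp: "v \<in> weyl R \<Longrightarrow> w \<in> weyl R \<Longrightarrow> v \<circ> w \<in> weyl R"
  unfolding weyl_def by (auto simp flip: refl_prod_append) (metis set_append Un_least)

abbreviation inv_fun :: "('a \<Rightarrow> 'b) \<Rightarrow> 'b \<Rightarrow> 'a" where
  "inv_fun \<equiv> inv_into UNIV"

lemma weyl_inv: "w \<in> weyl R \<Longrightarrow> inv_fun w \<in> weyl R"
proof -
  assume "w \<in> weyl R"
  then obtain as where as: "set as \<subseteq> R" "w = refl_prod as" unfolding weyl_def by blast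
  then have "inv_fun w = refl_prod (rev as)"
    using inv_unique_comp[OF refl_prod_rev' refl_prod_rev] by blast
  with as show ?thesis unfolding weyl_def by (auto intro!: exI[of _ "rev as"])
qed

lemma weyl_inv_comp: "w \<in> weyl R \<Longrightarrow> inv_fun w \<circ> w = id" "w \<in> weyl R \<Longrightarrow> w \<circ> inv_fun w = id"
  by (simp_all only: weyl_bij bij_is_inj bij_is_surj inv_o_cancel flip: surj_iff)

lemma weyl_inv_apply: "w \<in> weyl R \<Longrightarrow> inv_fun w (w v) = v" "w \<in> weyl R \<Longrightarrow> w (inv_fun w v) = v"
  using weyl_inv_comp by (metis comp_apply id_apply)+

lemma weyl_induct [consumes 1, case_names id step]:
  assumes "w \<in> weyl R" "Q id"
    and "\<And>a w. a \<in> R \<Longrightarrow> w \<in> weyl R \<Longrightarrow> Q w \<Longrightarrow> Q (root_refl a \<circ> w)"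
  shows "Q w"
proof -
  obtain as where "set as \<subseteq> R" "w = refl_prod as" using assms(1) unfolding weyl_def by blast
  then show ?thesis
    by (induction as arbitrary: w) (auto simp: assms(2) weyl_def intro!: assms(3))
qed

text \<open>\<open>BijGroup\<close> restricts its multiplication to its carrier, hence the
  \<open>bij\<close> premises.\<close>

lemma mult_weyl_group:
  "bij f \<Longrightarrow> bij g \<Longrightarrow> f \<otimes>\<^bsub>weyl_group R\<^esub> g = f \<circ> g"
  by (simp add: weyl_group_def BijGroup_UNIV)

lemma one_weyl_group: "\<one>\<^bsub>weyl_group R\<^esub> = id"
  by (simp add: weyl_group_def BijGroup_UNIV)

lemma inv_weyl_group:
  assumes "w \<in> weyl R"
  shows "inv\<^bsub>weyl_group R\<^esub> w = inv_fun w"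
proof -
  interpret group "weyl_group R" by (rule group_weyl_group)
  show ?thesis
    using assms weyl_inv[OF assms]
    by (intro inv_equality) (auto simp: carrier_weyl_group one_weyl_group mult_weyl_group weyl_bij weyl_inv_comp)
qed

lemma weyl_root_refl_conj:
  assumes "w \<in> weyl R"
  shows "w \<circ> root_refl a = root_refl (w a) \<circ> w"
  using root_refl_conj[OF weyl_linear[OF assms] weyl_inner[OF assms]] by (simp add: fun_eq_iff)

lemma foldr_weyl_group:
  "foldr (mult (weyl_group R)) (map root_refl as) \<one>\<^bsub>weyl_group R\<^esub> = refl_prod as"
  by (induction as) (simp_all add: one_weyl_group mult_weyl_group bij_root_refl refl_prod_bij)

lemma word_length_weyl_group:
  "word_length (weyl_group R) (root_refl ` B) w
     = (LEAST n. \<exists>as. length as = n \<and> set as \<subseteq> B \<and> refl_prod as = w)"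
proof -
  have "(\<exists>ws. length ws = n \<and> set ws \<subseteq> root_refl ` B \<and> foldr (mult (weyl_group R)) ws \<one>\<^bsub>weyl_group R\<^esub> = w)
    \<longleftrightarrow> (\<exists>as. length as = n \<and> set as \<subseteq> B \<and> refl_prod as = w)" for n
  proof
    assume "\<exists>ws. length ws = n \<and> set ws \<subseteq> root_refl ` B \<and> foldr (mult (weyl_group R)) ws \<one>\<^bsub>weyl_group R\<^esub> = w"
    then obtain ws where ws: "length ws = n" "set ws \<subseteq> root_refl ` B"
      "foldr (mult (weyl_group R)) ws \<one>\<^bsub>weyl_group R\<^esub> = w" by blast
    from ws(2) have "ws \<in> lists (root_refl ` B)" by auto
    then obtain as where "as \<in> lists B" "ws = map root_refl as"
      by (auto simp: lists_image)
    with ws show "\<exists>as. length as = n \<and> set as \<subseteq> B \<and> refl_prod as = w"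
      by (auto simp: foldr_weyl_group)
  next
    assume "\<exists>as. length as = n \<and> set as \<subseteq> B \<and> refl_prod as = w"
    then obtain as where "length as = n" "set as \<subseteq> B" "refl_prod as = w" by blast
    then show "\<exists>ws. length ws = n \<and> set ws \<subseteq> root_refl ` B \<and> foldr (mult (weyl_group R)) ws \<one>\<^bsub>weyl_group R\<^esub> = w"
      by (intro exI[of _ "map root_refl as"]) (auto simp: foldr_weyl_group)
  qed
  then show ?thesis by (simp add: word_length_def)
qed

text \<open>Weyl groups of different root sets are records with the same operations, so the carrier
  decides equality.\<close>

lemma weyl_group_cong: "weyl Q = weyl Q' \<Longrightarrow> weyl_group Q = weyl_group Q'"
  using carrier_weyl_group[of Q] carrier_weyl_group[of Q'] by (simp add: weyl_group_def)

lemma weyl_conj: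
  assumes "w \<in> weyl R" "u \<in> weyl Q"
  shows "w \<circ> u \<circ> inv_fun w \<in> weyl (w ` Q)"
  using assms(2)
proof (induction rule: weyl_induct)
  case id
  show ?case using weyl_inv_comp(2)[OF assms(1)] id_in_weyl by (metis comp_id)
next
  case (step a u)
  have "w \<circ> (root_refl a \<circ> u) \<circ> inv_fun w = root_refl (w a) \<circ> (w \<circ> u \<circ> inv_fun w)"
    using weyl_root_refl_conj[OF assms(1), of a] by (metis comp_assoc)
  then show ?case using step by (metis weyl_comp root_refl_in_weyl imageI)
qed

text \<open>A reflection in a root of \<open>U\<close> changes a vector by a multiple of that
  root.\<close>

lemma weyl_diff_in_subspace:
  assumes "subspace U" "w \<in> weyl (Q \<inter> U)"
  shows "w v - v \<in> U"
  using assms(2)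
proof (induction rule: weyl_induct)
  case id
  then show ?case using assms(1) by (simp add: subspace_0)
next
  case (step a w)
  have "root_refl a (w v) - v = (w v - v) - (2 * (w v \<bullet> a) / (a \<bullet> a)) *\<^sub>R a"
    by (simp add: root_refl_def)
  also have "\<dots> \<in> U"
    using step(1) by (intro subspace_diff[OF assms(1) step.IH] subspace_scale[OF assms(1)]) blast
  finally show ?case by simp
qed

text \<open>Indecomposability is a purely additive notion.\<close>

lemma simple_roots_image:
  assumes "linear f" "inj f"
  shows "simple_roots (f ` Q) = f ` simple_roots Q"
proof -
  have "f a = f b + f c \<longleftrightarrow> a = b + c" for a b c
    using assms by (metis linear_add inj_eq)
  then show ?thesis unfolding simple_roots_def by (auto simp: inj_image_mem_iff[OF assms(2)])
qed

section \<open>Root systems with a positive system\<close>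

text \<open>The regular vector is a parameter because a subsystem inherits its positive system from
  the same \<open>\<xi>\<close>, while the restricted roots get a vector of their own.\<close>

locale based_root_system =
  fixes R P :: "'a::euclidean_space set" and \<xi> :: 'a
  assumes root_sys: "root_system R"
    and regular: "a \<in> R \<Longrightarrow> a \<bullet> \<xi> \<noteq> 0"
    and pos_def: "P = {a \<in> R. a \<bullet> \<xi> > 0}"
begin

abbreviation "B \<equiv> simple_roots P"
abbreviation "W \<equiv> weyl R"
abbreviation "len \<equiv> word_length (weyl_group R) (root_refl ` B)"

section \<open>Positive roots and the base of simple roots\<close>

lemma finite_R: "finite R"
  and zero_notin: "0 \<notin> R"
  and refl_in_R: "a \<in> R \<Longrightarrow> b \<in> R \<Longrightarrow> root_refl a b \<in> R"
  and cartan_int: "a \<in> R \<Longrightarrow> b \<in> R \<Longrightarrow> 2 * (b \<bullet> a) / (a \<bullet> a) \<in> \<int>"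
  and multiple_root: "a \<in> R \<Longrightarrow> c *\<^sub>R a \<in> R \<Longrightarrow> c = 1 \<or> c = -1"
  using root_sys unfolding root_system_def by blast+

lemma uminus_in_R: "a \<in> R \<Longrightarrow> - a \<in> R"
  using refl_in_R[of a a] by simp

lemma P_subset: "P \<subseteq> R" and P_inner: "a \<in> P \<Longrightarrow> a \<bullet> \<xi> > 0"
  by (auto simp: pos_def)

lemma finite_P: "finite P"
  using finite_R P_subset by (rule finite_subset[rotated])

lemma B_subset: "B \<subseteq> P"
  by (auto simp: simple_roots_def)

lemma finite_B: "finite B"
  using finite_P B_subset by (rule finite_subset[rotated])

lemma notin_P_iff: "a \<in> R \<Longrightarrow> a \<notin> P \<longleftrightarrow> - a \<in> P"
  using regular[of a] uminus_in_R[of a] by (auto simp: pos_def)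

lemma uminus_notin_P: "a \<in> P \<Longrightarrow> - a \<notin> P"
  by (auto simp: pos_def)

lemma weyl_in_R: "w \<in> W \<Longrightarrow> a \<in> R \<Longrightarrow> w a \<in> R"
  by (induction w arbitrary: a rule: weyl_induct) (auto simp: refl_in_R)

lemma weyl_uminus: "w \<in> W \<Longrightarrow> w (- a) = - w a"
  by (simp add: weyl_linear linear_neg)

lemma root_refl_in_W: "a \<in> R \<Longrightarrow> root_refl a \<in> W"
  by (rule root_refl_in_weyl)

text \<open>The induction counts the positive roots of smaller value at \<open>\<xi>\<close>, a
  well-founded substitute for this real value; both summands of a decomposition lie strictly
  lower.\<close>

lemma positive_combination:
  assumes "a \<in> P"
  shows "\<exists>n::'a \<Rightarrow> nat. a = (\<Sum>b\<in>B. real (n b) *\<^sub>R b)"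
  using assms
proof (induction "card {c \<in> P. c \<bullet> \<xi> < a \<bullet> \<xi>}" arbitrary: a rule: less_induct)
  case less
  show ?case
  proof (cases "a \<in> B")
    case True
    have "(\<Sum>b\<in>B. real (if b = a then 1 else 0) *\<^sub>R b) = (\<Sum>b\<in>B. if b = a then a else 0)"
      by (rule sum.cong) auto
    also have "\<dots> = a" using True finite_B by simp
    finally show ?thesis by (intro exI[of _ "\<lambda>b. if b = a then 1 else 0"]) simp
  next
    case False
    with less.prems obtain b c where bc: "b \<in> P" "c \<in> P" "a = b + c"
      by (auto simp: simple_roots_def)
    then have lt: "b \<bullet> \<xi> < a \<bullet> \<xi>" "c \<bullet> \<xi> < a \<bullet> \<xi>"
      using P_inner[of b] P_inner[of c] by (auto simp: inner_add_left)
    have "{x \<in> P. x \<bullet> \<xi> < y \<bullet> \<xi>} \<subset> {x \<in> P. x \<bullet> \<xi> < a \<bullet> \<xi>}"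
      if "y \<in> P" "y \<bullet> \<xi> < a \<bullet> \<xi>" for y
      using that by auto
    then have "card {x \<in> P. x \<bullet> \<xi> < y \<bullet> \<xi>} < card {x \<in> P. x \<bullet> \<xi> < a \<bullet> \<xi>}"
      if "y \<in> P" "y \<bullet> \<xi> < a \<bullet> \<xi>" for y
      using that finite_P by (intro psubset_card_mono) auto
    then obtain n m :: "'a \<Rightarrow> nat"
      where "b = (\<Sum>x\<in>B. real (n x) *\<^sub>R x)" "c = (\<Sum>x\<in>B. real (m x) *\<^sub>R x)"
      using less.hyps bc lt by meson
    then have "a = (\<Sum>x\<in>B. real (n x + m x) *\<^sub>R x)"
      using bc(3) by (simp add: scaleR_left_distrib sum.distrib)
    then show ?thesis by (intro exI)
  qed
qed

text \<open>The two Cartan integers of an acute pair are positive with product below 4, so one of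
  them is 1. The corresponding reflection makes the difference of the two roots a root, and then one
  of them decomposes.\<close>

lemma simple_obtuse:
  assumes "a \<in> B" "b \<in> B" "a \<noteq> b"
  shows "a \<bullet> b \<le> 0"
proof (rule ccontr)
  assume "\<not> a \<bullet> b \<le> 0"
  then have pos: "a \<bullet> b > 0" by simp
  have ab: "a \<in> P" "b \<in> P" "a \<in> R" "b \<in> R" using assms B_subset P_subset by auto
  then have nz: "a \<bullet> a > 0" "b \<bullet> b > 0" using zero_notin by auto
  obtain m n where m: "2 * (a \<bullet> b) / (b \<bullet> b) = of_int m" and n: "2 * (a \<bullet> b) / (a \<bullet> a) = of_int n"
    using cartan_int[of b a] cartan_int[of a b] ab by (auto simp: Ints_def inner_commute)
  have "real_of_int m > 0" "real_of_int n > 0"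
    using pos nz by (auto simp flip: m n)
  then have mn: "m \<ge> 1" "n \<ge> 1" by auto
  have lt: "(a \<bullet> b)\<^sup>2 < (a \<bullet> a) * (b \<bullet> b)"
  proof -
    \<comment> \<open>The projection of \<open>a\<close> to the line through \<open>b\<close> has
      coefficient \<open>?c\<close>; a nonzero remainder gives strict inequality in
      Cauchy-Schwarz.\<close>
    let ?c = "(a \<bullet> b) / (b \<bullet> b)"
    have "a \<noteq> ?c *\<^sub>R b"
    proof
      assume "a = ?c *\<^sub>R b"
      then have "?c = 1 \<or> ?c = -1" using multiple_root[of b ?c] ab by metis
      moreover have "?c > 0" using pos nz by simp
      ultimately have "?c = 1" by linarith
      then show False using \<open>a = ?c *\<^sub>R b\<close> assms(3) by (metis scaleR_one)
    qed
    then have "(a - ?c *\<^sub>R b) \<bullet> (a - ?c *\<^sub>R b) > 0" by simp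
    also have "(a - ?c *\<^sub>R b) \<bullet> (a - ?c *\<^sub>R b) = a \<bullet> a - (a \<bullet> b)\<^sup>2 / (b \<bullet> b)"
      using nz by (simp add: inner_diff_left inner_diff_right inner_commute power2_eq_square)
    finally show ?thesis using nz by (simp add: field_simps)
  qed
  have "real_of_int (m * n) = 4 * ((a \<bullet> b)\<^sup>2 / ((a \<bullet> a) * (b \<bullet> b)))"
    using m n by (simp flip: m n add: power2_eq_square)
  also have "\<dots> < 4" using lt nz by (simp add: divide_less_eq)
  finally have "m * n < 4" by linarith
  then have "\<not> (2 \<le> m \<and> 2 \<le> n)" using mult_mono[of 2 m 2 n] by linarith
  then have "m = 1 \<or> n = 1" using mn by linarith
  then have "a - b \<in> R \<or> b - a \<in> R"
  proof
    assume "m = 1"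
    then have "root_refl b a = a - b" using m unfolding root_refl_def by (simp only: of_int_1 scaleR_one)
    then show ?thesis using refl_in_R ab by metis
  next
    assume "n = 1"
    then have "root_refl a b = b - a" using n inner_commute[of a b]
      unfolding root_refl_def by (simp only: of_int_1 scaleR_one)
    then show ?thesis using refl_in_R ab by metis
  qed
  then have "a - b \<in> P \<or> b - a \<in> P"
    using notin_P_iff uminus_in_R by (metis minus_diff_eq)
  moreover have "a = b + (a - b)" "b = a + (b - a)" by simp_all
  ultimately show False
    using assms ab unfolding simple_roots_def by blast
qed

text \<open>The positive and negative parts of a linear relation give the same vector. Obtuse angles
  make its square nonpositive, so it is 0, and pairing with \<open>\<xi>\<close> kills all
  coefficients because simple roots are positive there.\<close>

lemma independent_B: "independent B"
proof -
  have "\<forall>b\<in>B. u b = 0" if "(\<Sum>b\<in>B. u b *\<^sub>R b) = 0" for u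
  proof -
    define v where "v = (\<Sum>b\<in>B. max 0 (u b) *\<^sub>R b)"
    define v' where "v' = (\<Sum>b\<in>B. max 0 (- u b) *\<^sub>R b)"
    have "v - v' = (\<Sum>b\<in>B. u b *\<^sub>R b)"
      unfolding v_def v'_def sum_subtractf[symmetric] scaleR_left_diff_distrib[symmetric]
      by (rule sum.cong) (auto simp: max_def)
    then have "v = v'" using that by simp
    have "v \<bullet> v' = (\<Sum>b\<in>B. (max 0 (u b) *\<^sub>R b) \<bullet> v')"
      unfolding v_def by (rule inner_sum_left)
    also have "\<dots> = (\<Sum>b\<in>B. \<Sum>c\<in>B. max 0 (u b) * max 0 (- u c) * (b \<bullet> c))"
      unfolding v'_def inner_sum_right by (simp add: mult_ac)
    also have "\<dots> \<le> 0"
    proof (intro sum_nonpos)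
      fix b c assume bc: "b \<in> B" "c \<in> B"
      show "max 0 (u b) * max 0 (- u c) * (b \<bullet> c) \<le> 0"
      \<comment> \<open>On the diagonal one of the two truncated coefficients is 0; off it the angle
        is obtuse.\<close>
      proof (cases "b = c")
        case True
        then have "max 0 (u b) * max 0 (- u c) = 0" by (auto simp: max_def)
        then show ?thesis by (simp only: mult_zero_left)
      next
        case False
        then show ?thesis using simple_obtuse[OF bc] by (intro mult_nonneg_nonpos) auto
      qed
    qed
    finally have "v = 0" using \<open>v = v'\<close> by (metis inner_gt_zero_iff not_le)
    have zero: "\<forall>b\<in>B. max 0 (t b) = 0" if "(\<Sum>b\<in>B. max 0 (t b) *\<^sub>R b) = 0" for t
    proof -
      have "(\<Sum>b\<in>B. max 0 (t b) * (b \<bullet> \<xi>)) = (\<Sum>b\<in>B. max 0 (t b) *\<^sub>R b) \<bullet> \<xi>"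
        by (simp add: inner_sum_left)
      then have "(\<Sum>b\<in>B. max 0 (t b) * (b \<bullet> \<xi>)) = 0" using that by simp
      then have "\<forall>b\<in>B. max 0 (t b) * (b \<bullet> \<xi>) = 0"
        using P_inner B_subset finite_B
        by (subst (asm) sum_nonneg_eq_0_iff) (auto intro!: mult_nonneg_nonneg intro: less_imp_le)
      then show ?thesis using P_inner B_subset by fastforce
    qed
    show "\<forall>b\<in>B. u b = 0"
      using zero[of u] zero[of "\<lambda>b. - u b"] \<open>v = 0\<close> \<open>v = v'\<close>
      unfolding v_def v'_def by (force simp: max_def split: if_splits)
  qed
  then show ?thesis
    using finite_B independent_explicit by blast
qed

text \<open>By independence the values extend to a linear functional, which the inner product
  represents by a vector.\<close>

lemma dual_vector: "\<exists>\<omega>. \<forall>b\<in>B. b \<bullet> \<omega> = g b"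
proof -
  obtain f :: "'a \<Rightarrow> real" where f: "linear f" "\<forall>b\<in>B. f b = g b"
    using linear_independent_extend[OF independent_B] by metis
  have "f b = b \<bullet> (\<Sum>i\<in>Basis. f i *\<^sub>R i)" for b
  proof -
    have "f b = f (\<Sum>i\<in>Basis. (b \<bullet> i) *\<^sub>R i)" by (simp add: euclidean_representation)
    also have "\<dots> = (\<Sum>i\<in>Basis. (b \<bullet> i) * f i)"
      using f(1) by (simp add: linear_sum linear_cmul)
    finally show ?thesis by (simp add: inner_sum_right mult.commute)
  qed
  with f(2) show ?thesis by metis
qed

lemma inner_nonneg:
  assumes "a \<in> P" "\<And>b. b \<in> B \<Longrightarrow> b \<bullet> \<omega> \<ge> 0"
  shows "a \<bullet> \<omega> \<ge> 0"
proof -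
  obtain n :: "'a \<Rightarrow> nat" where "a = (\<Sum>b\<in>B. real (n b) *\<^sub>R b)"
    using positive_combination assms(1) by blast
  then have "a \<bullet> \<omega> = (\<Sum>b\<in>B. real (n b) * (b \<bullet> \<omega>))" by (simp add: inner_sum_left)
  then show ?thesis using assms(2) by (simp add: sum_nonneg)
qed

text \<open>Take \<open>\<omega>\<close> orthogonal to \<open>a\<close> and of value 1 on the other
  simple roots. The reflection in \<open>a\<close> does not change the value at
  \<open>\<omega>\<close>, which is nonnegative on positive roots and nonzero at \<open>b\<close>,
  since otherwise \<open>b\<close> would be a multiple of \<open>a\<close>.\<close>

lemma simple_refl_pos:
  assumes "a \<in> B" "b \<in> P" "b \<noteq> a"
  shows "root_refl a b \<in> P"
proof (rule ccontr)
  assume neg: "root_refl a b \<notin> P"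
  have R: "a \<in> R" "b \<in> R" "a \<in> P" using assms B_subset P_subset by auto
  obtain \<omega> where \<omega>: "\<And>c. c \<in> B \<Longrightarrow> c \<bullet> \<omega> = (if c = a then 0 else 1)"
    using dual_vector[of "\<lambda>c. if c = a then 0 else 1"] by blast
  have "b \<bullet> \<omega> \<noteq> 0"
  proof
    assume zero: "b \<bullet> \<omega> = 0"
    obtain n :: "'a \<Rightarrow> nat" where n: "b = (\<Sum>c\<in>B. real (n c) *\<^sub>R c)"
      using positive_combination assms(2) by blast
    then have "b \<bullet> \<omega> = (\<Sum>c\<in>B. real (n c) * (c \<bullet> \<omega>))" by (simp add: inner_sum_left)
    then have "(\<Sum>c\<in>B. real (n c) * (c \<bullet> \<omega>)) = 0" using zero by simp
    then have "\<forall>c\<in>B. real (n c) * (c \<bullet> \<omega>) = 0"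
      using finite_B \<omega> by (subst (asm) sum_nonneg_eq_0_iff) auto
    then have "n c = 0" if "c \<in> B" "c \<noteq> a" for c using that \<omega> by force
    then have "b = (\<Sum>c\<in>B. if c = a then real (n a) *\<^sub>R a else 0)"
      unfolding n by (intro sum.cong) auto
    then have b: "b = real (n a) *\<^sub>R a" using assms(1) finite_B by simp
    then have "real (n a) = 1 \<or> real (n a) = -1" using multiple_root R by metis
    with b assms(3) show False by auto
  qed
  moreover have "b \<bullet> \<omega> \<ge> 0" by (rule inner_nonneg[OF assms(2)]) (simp add: \<omega>)
  moreover have "root_refl a b \<bullet> \<omega> = b \<bullet> \<omega>"
    using \<omega>[OF assms(1)] by (simp add: root_refl_def inner_diff_left)
  moreover have "- root_refl a b \<bullet> \<omega> \<ge> 0"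
    by (rule inner_nonneg) (use neg notin_P_iff refl_in_R R in \<open>auto simp: \<omega>\<close>)
  ultimately show False by simp
qed

text \<open>A positive root \<open>a\<close> has a simple \<open>b\<close> with
  \<open>b \<bullet> a > 0\<close>, since otherwise \<open>a \<bullet> a\<close> would be
  nonpositive. If \<open>a\<close> is not simple, reflecting in \<open>b\<close> keeps it positive
  and lowers its value at \<open>\<xi>\<close>.\<close>

lemma conj_to_simple: "a \<in> P \<Longrightarrow> \<exists>w\<in>weyl B. w a \<in> B"
proof (induction "card {c \<in> P. c \<bullet> \<xi> < a \<bullet> \<xi>}" arbitrary: a rule: less_induct)
  case less
  show ?case
  proof (cases "a \<in> B")
    case True
    then show ?thesis by (intro bexI[of _ id]) auto
  next
    case False
    have "\<not> (\<forall>b\<in>B. b \<bullet> a \<le> 0)"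
    proof
      assume "\<forall>b\<in>B. b \<bullet> a \<le> 0"
      then have "a \<bullet> (- a) \<ge> 0" by (intro inner_nonneg[OF less.prems]) auto
      then have "a = 0" by (metis inner_gt_zero_iff inner_minus_right neg_0_le_iff_le not_le)
      then show False using less.prems P_subset zero_notin by auto
    qed
    then obtain b where b: "b \<in> B" "b \<bullet> a > 0" by (meson not_le)
    let ?c = "root_refl b a"
    have c: "?c \<in> P" using simple_refl_pos b less.prems False by metis
    have "b \<in> P" using b B_subset by auto
    then have "b \<bullet> \<xi> > 0" "b \<bullet> b > 0" using P_inner P_subset zero_notin by auto
    then have "?c \<bullet> \<xi> < a \<bullet> \<xi>"
      using b(2) by (simp add: root_refl_def inner_diff_left inner_commute[of a b])
    then have "{x \<in> P. x \<bullet> \<xi> < ?c \<bullet> \<xi>} \<subset> {x \<in> P. x \<bullet> \<xi> < a \<bullet> \<xi>}"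
      using c by auto
    then have "card {x \<in> P. x \<bullet> \<xi> < ?c \<bullet> \<xi>} < card {x \<in> P. x \<bullet> \<xi> < a \<bullet> \<xi>}"
      using finite_P by (intro psubset_card_mono) auto
    then obtain w where "w \<in> weyl B" "w ?c \<in> B" using less.hyps c by blast
    then show ?thesis
      using b(1) by (intro bexI[of _ "w \<circ> root_refl b"]) (auto intro: weyl_comp root_refl_in_weyl)
  qed
qed

text \<open>The reflection in a positive root is conjugate to a simple reflection by an element of
  \<open>weyl B\<close>, and opposite roots have the same reflection.\<close>

lemma weyl_simple: "W = weyl B"
proof -
  have pos: "root_refl a \<in> weyl B" if "a \<in> P" for a
  proof -
    obtain w where w: "w \<in> weyl B" "w a \<in> B" using conj_to_simple[OF \<open>a \<in> P\<close>] by blast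
    have "root_refl a = (inv_fun w \<circ> w) \<circ> root_refl a" using w by (simp add: weyl_inv_comp)
    also have "\<dots> = inv_fun w \<circ> root_refl (w a) \<circ> w"
      using w weyl_root_refl_conj by (metis comp_assoc)
    finally show ?thesis using w by (metis weyl_comp weyl_inv root_refl_in_weyl)
  qed
  have refl: "root_refl a \<in> weyl B" if "a \<in> R" for a
    using pos[of a] pos[of "- a"] that notin_P_iff[of a] by auto
  have "w \<in> weyl B" if "w \<in> W" for w
    using that by (induction rule: weyl_induct) (simp_all only: id_in_weyl weyl_comp refl)
  moreover have "weyl B \<subseteq> W" using B_subset P_subset by (intro weyl_mono) auto
  ultimately show ?thesis by blast
qed

text \<open>Follow the image of \<open>b\<close> through the suffixes of the word. Where it turns
  negative, it was equal to the letter being applied, by \<open>simple_refl_pos\<close>; deleting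
  that letter amounts to multiplying the word by the reflection in \<open>b\<close>.\<close>

lemma strong_exchange:
  assumes "set as \<subseteq> B" "b \<in> P" "refl_prod as b \<notin> P"
  shows "\<exists>bs. set bs \<subseteq> B \<and> length as = Suc (length bs) \<and> refl_prod bs = refl_prod as \<circ> root_refl b"
  using assms(1,3)
proof (induction as)
  case Nil
  then show ?case using assms(2) by simp
next
  case (Cons a as)
  have w: "refl_prod as \<in> W" using Cons.prems(1) unfolding weyl_simple by (auto simp: weyl_def)
  show ?case
  proof (cases "refl_prod as b \<in> P")
    case True
    then have "refl_prod as b = a"
      using simple_refl_pos[of a "refl_prod as b"] Cons.prems by auto
    then have "refl_prod as \<circ> root_refl b = root_refl a \<circ> refl_prod as"
      using weyl_root_refl_conj[OF w] by metis
    then have "refl_prod (a # as) \<circ> root_refl b = refl_prod as"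
      by (metis comp_assoc comp_id fun.map_id id_comp refl_prod_Cons root_refl_comp_self)
    then show ?thesis using Cons.prems(1) by (metis insert_subset length_Cons list.simps(15))
  next
    case False
    then obtain bs where bs: "set bs \<subseteq> B" "length as = Suc (length bs)" "refl_prod bs = refl_prod as \<circ> root_refl b"
      using Cons.IH Cons.prems(1) by (metis insert_subset list.simps(15))
    have "refl_prod (a # bs) = refl_prod (a # as) \<circ> root_refl b"
      by (simp only: refl_prod_Cons bs comp_assoc)
    moreover have "set (a # bs) \<subseteq> B" "length (a # as) = Suc (length (a # bs))"
      using bs(1,2) Cons.prems(1) by simp_all
    ultimately show ?thesis by blast
  qed
qed

section \<open>Length in the Weyl group\<close>

lemma len_le: "set as \<subseteq> B \<Longrightarrow> len (refl_prod as) \<le> length as"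
  unfolding word_length_weyl_group by (rule Least_le) auto

lemma reduced_word:
  assumes "w \<in> W"
  obtains as where "set as \<subseteq> B" "refl_prod as = w" "length as = len w"
proof -
  obtain bs where "set bs \<subseteq> B" "refl_prod bs = w"
    using assms unfolding weyl_simple by (auto simp only: weyl_def)
  then have "\<exists>as. length as = length bs \<and> set as \<subseteq> B \<and> refl_prod as = w"
    by (intro exI[of _ bs] conjI refl)
  then have "\<exists>n as. length as = n \<and> set as \<subseteq> B \<and> refl_prod as = w" by (rule exI)
  then have "\<exists>as. length as = len w \<and> set as \<subseteq> B \<and> refl_prod as = w"
    unfolding word_length_weyl_group by (rule LeastI_ex)
  then show ?thesis using that by blast
qed

lemma len_id [simp]: "len id = 0"
  using len_le[of "[]"] by simp

lemma len_eq_0: "w \<in> W \<Longrightarrow> len w = 0 \<longleftrightarrow> w = id"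
  using reduced_word[of w] by (metis len_id length_0_conv refl_prod_Nil)

lemma len_decreases:
  assumes "w \<in> W" "b \<in> P" "w b \<notin> P"
  shows "len (w \<circ> root_refl b) < len w"
proof -
  obtain as where as: "set as \<subseteq> B" "refl_prod as = w" "length as = len w"
    using reduced_word assms(1) by blast
  obtain bs where bs: "set bs \<subseteq> B" "length as = Suc (length bs)" "refl_prod bs = w \<circ> root_refl b"
    using strong_exchange[OF as(1) assms(2)] assms(3) unfolding as(2) by blast
  have "len (w \<circ> root_refl b) \<le> length bs" using len_le[OF bs(1)] unfolding bs(3) .
  then show ?thesis unfolding as(3)[symmetric] bs(2) by (rule le_imp_less_Suc)
qed

lemma len_increases:
  assumes "w \<in> W" "b \<in> P" "w b \<in> P"
  shows "len w < len (w \<circ> root_refl b)"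
proof -
  have "b \<in> R" using assms P_subset by auto
  then have wb: "w \<circ> root_refl b \<in> W" using assms(1) weyl_comp root_refl_in_W by blast
  have "(w \<circ> root_refl b) b \<notin> P"
    using uminus_notin_P[OF assms(3)] assms(1) by (simp add: weyl_uminus)
  from len_decreases[OF wb assms(2) this] show ?thesis
    unfolding comp_root_refl_cancel .
qed

text \<open>If \<open>w\<close> kept the base positive, multiplying by the last letter of a reduced
  word would lengthen \<open>w\<close>, although it deletes that letter.\<close>

lemma ex_simple_neg:
  assumes "w \<in> W" "w \<noteq> id"
  shows "\<exists>b\<in>B. w b \<notin> P"
proof (rule ccontr)
  assume neg: "\<not> (\<exists>b\<in>B. w b \<notin> P)"
  obtain as where as: "set as \<subseteq> B" "refl_prod as = w" "length as = len w"
    using reduced_word assms(1) by blast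
  have "as \<noteq> []" using as(2) assms(2) by auto
  then obtain bs b where bs: "as = bs @ [b]" by (meson rev_exhaust)
  then have b: "b \<in> B" "b \<in> P" and "set bs \<subseteq> B" using as(1) B_subset by auto
  then have "w b \<in> P" using neg by blast
  then have "len w < len (w \<circ> root_refl b)" using len_increases assms(1) b by blast
  also have "w \<circ> root_refl b = refl_prod bs"
    unfolding as(2)[symmetric] bs by (rule ext) simp
  also have "len \<dots> \<le> length bs" by (rule len_le) fact
  finally show False using as(3) bs by simp
qed

lemma eq_id_if_pos:
  assumes "w \<in> W" "\<And>a. a \<in> P \<Longrightarrow> w a \<in> P"
  shows "w = id"
  using ex_simple_neg assms B_subset by blast

text \<open>An element is determined by its action on the finite set \<open>R\<close>: if two agree
  there, their quotient fixes all positive roots and \<open>eq_id_if_pos\<close> applies.\<close>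

lemma finite_W: "finite W"
proof -
  let ?r = "\<lambda>w. restrict w R"
  have "inj_on ?r W"
  proof (rule inj_onI)
    fix v w assume vw: "v \<in> W" "w \<in> W" "?r v = ?r w"
    then have "v a = w a" if "a \<in> R" for a using that by (metis restrict_apply')
    then have "(inv_fun v \<circ> w) a = a" if "a \<in> R" for a
      using that vw(1) by (metis comp_apply weyl_inv_apply(1))
    then have "inv_fun v \<circ> w = id"
      using vw P_subset by (intro eq_id_if_pos weyl_comp weyl_inv) auto
    then show "v = w" using vw by (metis comp_assoc comp_id weyl_inv_comp(2) id_comp)
  qed
  moreover have "?r ` W \<subseteq> R \<rightarrow>\<^sub>E R" using weyl_in_R by auto
  then have "finite (?r ` W)" using finite_R by (meson finite_PiE finite_subset)
  ultimately show ?thesis by (simp only: finite_image_iff)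
qed

text \<open>In the quotient \<open>inv_fun v \<circ> w\<close> the two sign changes cancel.\<close>

lemma eq_if_pos_eq:
  assumes "v \<in> W" "w \<in> W" "\<And>a. a \<in> P \<Longrightarrow> v a \<notin> P" "\<And>a. a \<in> P \<Longrightarrow> w a \<notin> P"
  shows "v = w"
proof -
  have "inv_fun v \<circ> w = id"
  proof (rule eq_id_if_pos)
    show "inv_fun v \<circ> w \<in> W" using assms by (intro weyl_comp weyl_inv)
    fix a assume a: "a \<in> P"
    show "(inv_fun v \<circ> w) a \<in> P"
    proof (rule ccontr)
      assume n: "(inv_fun v \<circ> w) a \<notin> P"
      let ?b = "- inv_fun v (w a)"
      have "w a \<in> R" using a assms(2) P_subset weyl_in_R by auto
      then have "?b \<in> P"
        using n weyl_in_R[OF weyl_inv[OF assms(1)]] notin_P_iff by (metis comp_apply)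
      then have "v ?b \<notin> P" using assms(3) by blast
      moreover have "v ?b = - w a" using assms(1) by (simp add: weyl_uminus weyl_inv_apply)
      moreover have "- w a \<in> P" using assms(4)[OF a] \<open>w a \<in> R\<close> notin_P_iff by blast
      ultimately show False by simp
    qed
  qed
  then show ?thesis using assms by (metis comp_assoc comp_id weyl_inv_comp(2) id_comp)
qed

section \<open>The longest element\<close>

abbreviation "w0 \<equiv> longest_element (weyl_group R) (root_refl ` B)"

text \<open>An element of maximal length makes every positive root negative, since otherwise a
  reflection would lengthen it. By \<open>eq_if_pos_eq\<close> this determines it, so the definite
  description denotes.\<close>

lemma w0_in_W: "w0 \<in> W"
  and w0_neg: "a \<in> P \<Longrightarrow> w0 a \<notin> P"
proof -
  let ?L = "\<lambda>w. w \<in> W \<and> (\<forall>v\<in>W. len v \<le> len w)"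
  have neg: "w a \<notin> P" if "?L w" "a \<in> P" for w a
  proof
    assume "w a \<in> P"
    then have "len w < len (w \<circ> root_refl a)" using len_increases that by blast
    moreover have "w \<circ> root_refl a \<in> W"
      using that P_subset by (auto intro: weyl_comp root_refl_in_W)
    ultimately show False using that(1) by (meson not_le)
  qed
  obtain w where w: "?L w"
  proof -
    have "Max (len ` W) \<in> len ` W" using finite_W by (intro Max_in) (auto intro: id_in_weyl)
    then obtain w where w: "w \<in> W" "len w = Max (len ` W)" by (metis imageE)
    then have "len v \<le> len w" if "v \<in> W" for v using that finite_W by simp
    with w(1) show ?thesis using that by blast
  qed
  have "v = u" if "?L v" "?L u" for v u
    using that eq_if_pos_eq[of v u] neg by blast
  then have L: "?L w0" unfolding longest_element_def carrier_weyl_group using w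
    by (intro theI[where P = ?L])
  then show "w0 \<in> W" by blast
  show "w0 a \<notin> P" if "a \<in> P" using neg L that by blast
qed

lemma w0_unique:
  assumes "w \<in> W" "\<And>a. a \<in> P \<Longrightarrow> w a \<notin> P"
  shows "w = w0"
  using eq_if_pos_eq assms w0_in_W w0_neg by blast

lemma uminus_w0_pos: "a \<in> P \<Longrightarrow> - w0 a \<in> P"
  using w0_neg w0_in_W weyl_in_R notin_P_iff P_subset by blast

lemma w0_w0: "w0 \<circ> w0 = id"
proof (rule eq_id_if_pos)
  show "w0 \<circ> w0 \<in> W" by (intro weyl_comp w0_in_W)
  show "(w0 \<circ> w0) a \<in> P" if "a \<in> P" for a
    using uminus_w0_pos[OF uminus_w0_pos[OF that]] by (simp add: weyl_uminus[OF w0_in_W])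
qed

text \<open>\<open>- w0\<close> is an additive involution of the positive roots, so it preserves
  indecomposability.\<close>

lemma w0_simple:
  assumes "b \<in> B"
  shows "- w0 b \<in> B"
proof (rule ccontr)
  assume nB: "- w0 b \<notin> B"
  have "b \<in> P" using assms B_subset by blast
  then obtain x y where xy: "x \<in> P" "y \<in> P" "- w0 b = x + y"
    using nB uminus_w0_pos unfolding simple_roots_def by blast
  have "- w0 x + - w0 y = - w0 (- w0 b)"
    unfolding xy(3) by (simp add: weyl_linear[OF w0_in_W] linear_add)
  also have "\<dots> = (w0 \<circ> w0) b" by (simp add: weyl_uminus[OF w0_in_W])
  also have "\<dots> = b" unfolding w0_w0 by simp
  finally show False
    using assms uminus_w0_pos[OF xy(1)] uminus_w0_pos[OF xy(2)] unfolding simple_roots_def by blast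
qed

section \<open>Reflections and the Bruhat order\<close>

lemma coxeter_reflections_weyl:
  "coxeter_reflections (weyl_group R) (root_refl ` B) = root_refl ` P"
proof (intro equalityI subsetI)
  have conj: "w \<otimes>\<^bsub>weyl_group R\<^esub> root_refl b \<otimes>\<^bsub>weyl_group R\<^esub> inv\<^bsub>weyl_group R\<^esub> w = root_refl (w b)"
    if "w \<in> W" for w b
  proof -
    have "w \<circ> root_refl b \<circ> inv_fun w = root_refl (w b) \<circ> (w \<circ> inv_fun w)"
      using that weyl_root_refl_conj by (metis comp_assoc)
    then show ?thesis
      using that weyl_inv[OF that] by (simp add: mult_weyl_group weyl_bij bij_root_refl inv_weyl_group bij_comp weyl_inv_comp)
  qed
  {
    fix t assume "t \<in> coxeter_reflections (weyl_group R) (root_refl ` B)"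
    then obtain w b where wb: "w \<in> W" "b \<in> B" "t = root_refl (w b)"
      unfolding coxeter_reflections_def carrier_weyl_group using conj by blast
    then have "w b \<in> R" using weyl_in_R B_subset P_subset by blast
    then show "t \<in> root_refl ` P"
      using wb(3) notin_P_iff[of "w b"] root_refl_minus[of "w b"] by (metis imageI)
  }
  fix t assume "t \<in> root_refl ` P"
  then obtain a where a: "a \<in> P" "t = root_refl a" by blast
  have "\<exists>w\<in>W. \<exists>b\<in>B. w b = a"
    using conj_to_simple[OF a(1)] weyl_inv weyl_inv_apply(1) unfolding weyl_simple by metis
  then obtain w b where "w \<in> W" "b \<in> B" "w b = a" by blast
  then show "t \<in> coxeter_reflections (weyl_group R) (root_refl ` B)"
    unfolding coxeter_reflections_def carrier_weyl_group using conj a(2) by (metis (mono_tags, lifting) imageI mem_Collect_eq)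
qed

text \<open>In this form a step is checked on roots, which is what restriction can carry from one
  Weyl group to another.\<close>

lemma bruhat_step_iff:
  "bruhat_step (weyl_group R) (root_refl ` B) u v
    \<longleftrightarrow> u \<in> W \<and> (\<exists>a\<in>P. v = u \<circ> root_refl a \<and> u a \<in> P)"
proof (cases "u \<in> W")
  case True
  have "len u < len (u \<circ> root_refl a) \<longleftrightarrow> u a \<in> P" if "a \<in> P" for a
    using len_increases[OF True that] len_decreases[OF True that] by (meson not_less_iff_gr_or_eq)
  with True show ?thesis
    unfolding bruhat_step_def coxeter_reflections_weyl carrier_weyl_group
    by (auto simp: mult_weyl_group weyl_bij bij_root_refl)
qed (simp add: bruhat_step_def carrier_weyl_group)

abbreviation "ble \<equiv> bruhat_le (weyl_group R) (root_refl ` B)"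

lemma ble_refl [simp]: "ble u u"
  by (simp add: bruhat_le_def)

lemma ble_trans: "ble u v \<Longrightarrow> ble v w \<Longrightarrow> ble u w"
  by (simp add: bruhat_le_def)

lemma ble_step:
  "u \<in> W \<Longrightarrow> a \<in> P \<Longrightarrow> u a \<in> P \<Longrightarrow> ble u (u \<circ> root_refl a)"
  unfolding bruhat_le_def using bruhat_step_iff by blast

lemma ble_step':
  assumes "u \<in> W" "a \<in> P" "u a \<notin> P"
  shows "ble (u \<circ> root_refl a) u"
proof -
  have "a \<in> R" "u a \<in> R" using assms P_subset weyl_in_R by auto
  then have "ble (u \<circ> root_refl a) (u \<circ> root_refl a \<circ> root_refl a)"
    using assms notin_P_iff
    by (intro ble_step weyl_comp root_refl_in_W) (auto simp: weyl_uminus)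
  then show ?thesis by (simp only: comp_root_refl_cancel)
qed

lemma ble_len: "ble u v \<Longrightarrow> len u \<le> len v"
  unfolding bruhat_le_def by (induction rule: rtranclp_induct) (auto simp: bruhat_step_def)

lemma ble_in_W:
  assumes "ble u v" "u \<in> W"
  shows "v \<in> W"
  using assms unfolding bruhat_le_def
  by (induction rule: rtranclp_induct) (use P_subset in \<open>auto simp: bruhat_step_iff intro!: weyl_comp root_refl_in_W\<close>)

text \<open>For a positive root \<open>b\<close>, \<open>low\<close> and \<open>high\<close> pick
  the smaller and the larger of \<open>u\<close> and \<open>u \<circ> root_refl b\<close> in the
  Bruhat order, so that the lifting property can be stated without cases.\<close>

definition low :: "'a \<Rightarrow> ('a \<Rightarrow> 'a) \<Rightarrow> 'a \<Rightarrow> 'a" where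
  "low b u = (if u b \<in> P then u else u \<circ> root_refl b)"

definition high :: "'a \<Rightarrow> ('a \<Rightarrow> 'a) \<Rightarrow> 'a \<Rightarrow> 'a" where
  "high b u = (if u b \<in> P then u \<circ> root_refl b else u)"

lemma ble_low_high:
  assumes "u \<in> W" "b \<in> P"
  shows "ble (low b u) u" "ble u (high b u)" "ble (low b u) (u \<circ> root_refl b)"
    "ble (u \<circ> root_refl b) (high b u)"
  using assms by (auto simp: low_def high_def intro: ble_step ble_step')

text \<open>A step \<open>u \<rightarrow> u s\<^sub>a\<close> with \<open>a \<noteq> b\<close> is carried by right multiplication with \<open>s\<^sub>b\<close> to the step
  \<open>u s\<^sub>b \<rightarrow> u s\<^sub>b s\<^sub>c\<close>, where \<open>c = s\<^sub>b a\<close> is positive because \<open>b\<close> is simple.\<close>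

lemma lifting:
  assumes "ble u v" "u \<in> W" "b \<in> B"
  shows "ble (low b u) (low b v)" "ble (high b u) (high b v)"
proof -
  have bP: "b \<in> P" and bR: "b \<in> R" using assms(3) B_subset P_subset by auto
  have "ble (low b u) (low b v) \<and> ble (high b u) (high b v)"
    using assms(1) unfolding bruhat_le_def
  proof (induction rule: rtranclp_induct)
    case base
    then show ?case by simp
  next
    case (step v w)
    have v: "v \<in> W" using ble_in_W step(1) assms(2) unfolding bruhat_le_def by blast
    obtain a where a: "a \<in> P" "w = v \<circ> root_refl a" "v a \<in> P"
      using step(2) bruhat_step_iff by blast
    have aR: "a \<in> R" using a P_subset by auto
    have w: "w \<in> W" using a v aR by (auto intro: weyl_comp root_refl_in_W)
    have "ble (low b v) (low b w) \<and> ble (high b v) (high b w)"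
    proof (cases "a = b")
      case True
      have "v b \<in> R" using v bR weyl_in_R by auto
      then show ?thesis using True a uminus_notin_P v
        by (simp add: low_def high_def weyl_uminus)
    next
      case False
      let ?c = "root_refl b a"
      have c: "?c \<in> P" using simple_refl_pos False a assms(3) by blast
      have "root_refl b \<circ> root_refl ?c = root_refl a \<circ> root_refl b"
        using weyl_root_refl_conj[OF root_refl_in_W[OF bR], of ?c] by simp
      then have "v \<circ> root_refl b \<circ> root_refl ?c = w \<circ> root_refl b"
        using a(2) by (metis comp_assoc)
      moreover have "ble (v \<circ> root_refl b) (v \<circ> root_refl b \<circ> root_refl ?c)"
        using c a v bR by (intro ble_step weyl_comp root_refl_in_W) auto
      ultimately have vs: "ble (v \<circ> root_refl b) (w \<circ> root_refl b)" by simp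
      have vw: "ble v w" using a v by (auto intro: ble_step)
      have "ble (low b v) (low b w)"
        using ble_low_high[OF v bP] vs vw unfolding low_def[of b w] by (auto intro: ble_trans)
      moreover have "ble (high b v) (high b w)"
        using ble_low_high[OF w bP] vs vw unfolding high_def[of b v] by (auto intro: ble_trans)
      ultimately show ?thesis by blast
    qed
    then show ?case using step.IH by (auto simp: bruhat_le_def)
  qed
  then show "ble (low b u) (low b v)" "ble (high b u) (high b v)" by blast+
qed

section \<open>Subsystems cut out by a linear subspace\<close>

lemma subsystem:
  assumes "subspace U"
  shows "based_root_system (R \<inter> U) (P \<inter> U) \<xi>"
proof
  have refl: "root_refl a b \<in> R \<inter> U" if "a \<in> R \<inter> U" "b \<in> R \<inter> U" for a b
    using that refl_in_R assms by (auto simp: root_refl_def subspace_diff subspace_scale)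
  have "root_refl a ` (R \<inter> U) = R \<inter> U" if "a \<in> R \<inter> U" for a
  proof
    show "R \<inter> U \<subseteq> root_refl a ` (R \<inter> U)"
    proof
      fix b assume "b \<in> R \<inter> U"
      then show "b \<in> root_refl a ` (R \<inter> U)"
        using refl[OF that] by (intro image_eqI[of _ _ "root_refl a b"]) auto
    qed
  qed (use refl that in blast)
  then show "root_system (R \<inter> U)"
    unfolding root_system_def using finite_R zero_notin cartan_int multiple_root by blast
qed (use regular in \<open>auto simp: pos_def\<close>)

text \<open>Fewer positive roots leave fewer decompositions.\<close>

lemma simple_in_subsystem: "b \<in> B \<Longrightarrow> b \<in> U \<Longrightarrow> b \<in> simple_roots (P \<inter> U)"
  by (auto simp: simple_roots_def)

lemma combination_nonneg:
  assumes "linear f" "\<And>b. b \<in> B \<Longrightarrow> f b \<bullet> \<zeta> \<ge> 0" "a \<in> P"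
  shows "f a \<bullet> \<zeta> \<ge> 0"
proof -
  obtain n :: "'a \<Rightarrow> nat" where "a = (\<Sum>b\<in>B. real (n b) *\<^sub>R b)"
    using positive_combination assms(3) by blast
  then have "f a = (\<Sum>b\<in>B. real (n b) *\<^sub>R f b)"
    using assms(1) by (simp add: linear_sum linear_cmul)
  then have "f a \<bullet> \<zeta> = (\<Sum>b\<in>B. real (n b) * (f b \<bullet> \<zeta>))" by (simp add: inner_sum_left)
  then show ?thesis using assms(2) by (simp add: sum_nonneg)
qed

text \<open>The image is a nonnegative combination of positive roots, hence nonnegative at
  \<open>\<xi>\<close>, and regularity excludes the value 0.\<close>

lemma pos_on_subsystem:
  assumes "subspace U" "x \<in> W" "\<And>b. b \<in> simple_roots (P \<inter> U) \<Longrightarrow> x b \<in> P" "a \<in> P \<inter> U"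
  shows "x a \<in> P"
proof -
  interpret sub: based_root_system "R \<inter> U" "P \<inter> U" \<xi>
    by (rule subsystem) fact
  have "x a \<bullet> \<xi> \<ge> 0"
    using assms(3) P_inner
    by (intro sub.combination_nonneg[OF weyl_linear[OF assms(2)] _ assms(4)]) (simp add: less_imp_le)
  moreover have "x a \<in> R" using weyl_in_R[OF assms(2)] assms(4) P_subset by blast
  ultimately show ?thesis using regular[of "x a"] by (simp add: pos_def)
qed

text \<open>\<open>u\<close> is built up by reflections in simple roots of the subsystem. Such a
  root may decompose in \<open>P\<close>, but its reflection still belongs to \<open>W\<close>, and
  each step goes up because \<open>x\<close> preserves signs on the subsystem.\<close>

lemma ble_subsystem:
  assumes "subspace U" "x \<in> W" "\<And>a. a \<in> P \<inter> U \<Longrightarrow> x a \<in> P" "u \<in> weyl (R \<inter> U)"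
  shows "ble x (x \<circ> u)"
proof -
  interpret sub: based_root_system "R \<inter> U" "P \<inter> U" \<xi>
    by (rule subsystem) fact
  show ?thesis
    using assms(4)
  proof (induction "sub.len u" arbitrary: u rule: less_induct)
    case less
    show ?case
    proof (cases "u = id")
      case True
      then show ?thesis by simp
    next
      case False
      then obtain b where b: "b \<in> sub.B" "u b \<notin> P \<inter> U"
        using sub.ex_simple_neg less.prems by blast
      then have bP: "b \<in> P \<inter> U" "b \<in> R \<inter> U" using sub.B_subset sub.P_subset by auto
      let ?v = "u \<circ> root_refl b"
      have v: "?v \<in> weyl (R \<inter> U)" using less.prems bP by (intro weyl_comp root_refl_in_weyl)
      then have vW: "x \<circ> ?v \<in> W"
        using assms(2) weyl_mono[of "R \<inter> U" R] weyl_comp by blast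
      have "ble x (x \<circ> ?v)"
        using sub.len_decreases[OF less.prems bP(1) b(2)] v by (rule less.hyps)
      moreover have "- u b \<in> P \<inter> U"
        using b(2) sub.notin_P_iff sub.weyl_in_R less.prems bP(2) by blast
      then have "(x \<circ> ?v) b \<in> P" using assms(3) sub.weyl_uminus[OF less.prems] by simp
      then have "ble (x \<circ> ?v) (x \<circ> ?v \<circ> root_refl b)"
        using bP vW by (intro ble_step) auto
      moreover have "x \<circ> ?v \<circ> root_refl b = x \<circ> u" by (rule ext) simp
      ultimately show ?thesis using ble_trans by metis
    qed
  qed
qed

text \<open>\<open>v\<close> is peeled off from the right by applying \<open>low\<close> to both
  sides, which stays in the coset of \<open>x\<close> on the left. Once \<open>v\<close> is used up,
  \<open>x\<close> lies below what remains by \<open>ble_subsystem\<close>. The inclusion in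
  \<open>B\<close> makes \<open>lifting\<close> applicable to the letters of
  \<open>v\<close>.\<close>

lemma ble_projection:
  assumes "subspace U" "simple_roots (P \<inter> U) \<subseteq> B"
    and x: "x \<in> W" "\<And>a. a \<in> P \<inter> U \<Longrightarrow> x a \<in> P"
    and y: "y \<in> W" "\<And>a. a \<in> P \<inter> U \<Longrightarrow> y a \<in> P"
    and "u \<in> weyl (R \<inter> U)" "v \<in> weyl (R \<inter> U)" "ble (x \<circ> u) (y \<circ> v)"
  shows "ble x y"
proof -
  interpret sub: based_root_system "R \<inter> U" "P \<inter> U" \<xi>
    by (rule subsystem) fact
  show ?thesis
    using assms(7-)
  proof (induction "sub.len v" arbitrary: u v rule: less_induct)
    case less
    show ?case
    proof (cases "v = id")
      case True
      then have "ble (x \<circ> u) y" using less.prems(3) by simp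
      then show ?thesis using ble_subsystem[OF assms(1) x] less.prems(1) ble_trans by blast
    next
      case False
      then obtain b where b: "b \<in> sub.B" "v b \<notin> P \<inter> U"
        using sub.ex_simple_neg less.prems by blast
      then have bP: "b \<in> P \<inter> U" "b \<in> R \<inter> U" "b \<in> B"
        using sub.B_subset sub.P_subset assms(2) by auto
      have "- v b \<in> P \<inter> U"
        using b(2) sub.notin_P_iff sub.weyl_in_R less.prems(2) bP(2) by blast
      then have "- y (v b) \<in> P" using y(2) weyl_uminus[OF y(1)] by metis
      then have "(y \<circ> v) b \<notin> P" using uminus_notin_P by fastforce
      then have low_y: "low b (y \<circ> v) = y \<circ> (v \<circ> root_refl b)" by (simp add: low_def comp_def)
      have "low b (x \<circ> u) = x \<circ> u \<or> low b (x \<circ> u) = x \<circ> (u \<circ> root_refl b)"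
        by (simp add: low_def comp_def)
      then obtain u' where u': "u' \<in> weyl (R \<inter> U)" "low b (x \<circ> u) = x \<circ> u'"
        using less.prems(1) weyl_comp root_refl_in_weyl[OF bP(2)] by blast
      have "x \<circ> u \<in> W"
        using less.prems(1) x(1) weyl_mono[of "R \<inter> U" R] weyl_comp by blast
      from lifting(1)[OF less.prems(3) this bP(3)]
      have "ble (x \<circ> u') (y \<circ> (v \<circ> root_refl b))" unfolding low_y u'(2) .
      moreover have "v \<circ> root_refl b \<in> weyl (R \<inter> U)"
        using less.prems(2) bP by (intro weyl_comp root_refl_in_weyl)
      ultimately show ?thesis
        using less.hyps[OF sub.len_decreases[OF less.prems(2) bP(1) b(2)] u'(1)] by blast
    qed
  qed
qed

text \<open>For the reverse inclusion, the preimage of a positive root is positive: otherwise its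
  negative would be a positive root of \<open>U\<close> with negative image.\<close>

lemma image_pos_subsystem:
  assumes "subspace U" "subspace U'" "w \<in> W" "\<And>v. w v \<in> U' \<longleftrightarrow> v \<in> U"
    "\<And>b. b \<in> simple_roots (P \<inter> U) \<Longrightarrow> w b \<in> P"
  shows "w ` (P \<inter> U) = P \<inter> U'"
proof
  have pos: "w a \<in> P" if "a \<in> P \<inter> U" for a
    using pos_on_subsystem[OF assms(1,3,5) that] .
  then show "w ` (P \<inter> U) \<subseteq> P \<inter> U'" using assms(4) by blast
  show "P \<inter> U' \<subseteq> w ` (P \<inter> U)"
  proof
    fix x assume x: "x \<in> P \<inter> U'"
    define y where "y = inv_fun w x"
    have wy: "w y = x" unfolding y_def using weyl_inv_apply(2)[OF assms(3)] .
    have y: "y \<in> R" "y \<in> U"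
      using x weyl_in_R[OF weyl_inv[OF assms(3)]] P_subset assms(4)[of y] wy unfolding y_def by auto
    have "y \<in> P"
    proof (rule ccontr)
      assume "y \<notin> P"
      then have "- y \<in> P \<inter> U" using y notin_P_iff subspace_neg[OF assms(1)] by blast
      then have "- x \<in> P" using pos weyl_uminus[OF assms(3), of y] wy by metis
      then show False using x uminus_notin_P by blast
    qed
    then show "x \<in> w ` (P \<inter> U)" using wy y by blast
  qed
qed

text \<open>The conjugate by \<open>w\<close> of the longest element for \<open>U\<close> makes all
  positive roots of \<open>U'\<close> negative, and \<open>w0_unique\<close> identifies it.\<close>

lemma longest_conj:
  assumes "subspace U" "subspace U'" "w \<in> W" "w ` (P \<inter> U) = P \<inter> U'"
  shows "longest_element (weyl_group (R \<inter> U')) (root_refl ` simple_roots (P \<inter> U')) \<circ> w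
    = w \<circ> longest_element (weyl_group (R \<inter> U)) (root_refl ` simple_roots (P \<inter> U))"
proof -
  interpret s: based_root_system "R \<inter> U" "P \<inter> U" \<xi> by (rule subsystem) fact
  interpret t: based_root_system "R \<inter> U'" "P \<inter> U'" \<xi> by (rule subsystem) fact
  have "w ` (R \<inter> U) \<subseteq> R \<inter> U'"
  proof
    fix x assume "x \<in> w ` (R \<inter> U)"
    then obtain a where a: "a \<in> R \<inter> U" "x = w a" by blast
    show "x \<in> R \<inter> U'"
    proof (cases "a \<in> P \<inter> U")
      case True
      then show ?thesis using a(2) assms(4) t.P_subset by blast
    next
      case False
      then have "- a \<in> P \<inter> U" using a(1) s.notin_P_iff by blast
      then have "- x \<in> P \<inter> U'" using a(2) assms(4) weyl_uminus[OF assms(3), of a] by (metis imageI)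
      then show ?thesis using t.P_subset t.uminus_in_R[of "- x"] by auto
    qed
  qed
  then have in_W: "w \<circ> s.w0 \<circ> inv_fun w \<in> weyl (R \<inter> U')"
    using weyl_conj[OF assms(3) s.w0_in_W] weyl_mono by blast
  have "w \<circ> s.w0 \<circ> inv_fun w = t.w0"
  proof (rule t.w0_unique[OF in_W])
    fix a assume "a \<in> P \<inter> U'"
    then obtain b where b: "b \<in> P \<inter> U" "a = w b" using assms(4) by blast
    have "w (- s.w0 b) \<in> P \<inter> U'" using s.uminus_w0_pos[OF b(1)] assms(4) by blast
    then have "- w (s.w0 b) \<in> P \<inter> U'" using weyl_uminus[OF assms(3)] by metis
    then have "w (s.w0 b) \<notin> P \<inter> U'" using t.uminus_notin_P by fastforce
    then show "(w \<circ> s.w0 \<circ> inv_fun w) a \<notin> P \<inter> U'"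
      using b(2) weyl_inv_apply(1)[OF assms(3)] by simp
  qed
  then have "t.w0 \<circ> w = w \<circ> s.w0 \<circ> inv_fun w \<circ> w" by (simp only:)
  also have "\<dots> = w \<circ> s.w0 \<circ> (inv_fun w \<circ> w)" by (rule comp_assoc)
  also have "\<dots> = w \<circ> s.w0" by (simp only: weyl_inv_comp(1)[OF assms(3)] comp_id)
  finally show ?thesis .
qed

end

section \<open>Isomorphisms of groups with generators\<close>

lemma (in group) ord_2_iff:
  assumes "x \<in> carrier G"
  shows "ord x = 2 \<longleftrightarrow> x \<otimes> x = \<one> \<and> x \<noteq> \<one>"
proof -
  have "x [^] (2::nat) = x \<otimes> x" using assms by (simp add: numeral_2_eq_2)
  then have "x \<otimes> x = \<one> \<longleftrightarrow> ord x dvd 2" using assms pow_eq_id by metis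
  moreover have "ord x dvd 2 \<longleftrightarrow> ord x = 1 \<or> ord x = 2"
    using prime_nat_iff two_is_prime_nat by (metis dvd_refl one_dvd)
  ultimately show ?thesis using ord_eq_1[OF assms] by auto
qed

lemma word_length_iso:
  assumes G: "group G" and H: "group H" and \<phi>: "\<phi> \<in> iso G H" and S: "S \<subseteq> carrier G" and x: "x \<in> carrier G"
  shows "word_length H (\<phi> ` S) (\<phi> x) = word_length G S x"
proof -
  interpret G: group G by fact
  interpret H: group H by fact
  interpret group_hom G H \<phi> using \<phi> by unfold_locales (auto simp: iso_def)
  have inj: "inj_on \<phi> (carrier G)" using \<phi> by (simp add: iso_def bij_betw_def)
  have closed: "foldr (mult G) ws \<one>\<^bsub>G\<^esub> \<in> carrier G" if "set ws \<subseteq> carrier G" for ws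
    using that by (induction ws) auto
  have fold: "foldr (mult H) (map \<phi> ws) \<one>\<^bsub>H\<^esub> = \<phi> (foldr (mult G) ws \<one>\<^bsub>G\<^esub>)"
    if "set ws \<subseteq> carrier G" for ws
    using that closed by (induction ws) auto
  have "(\<exists>ws. length ws = n \<and> set ws \<subseteq> \<phi> ` S \<and> foldr (mult H) ws \<one>\<^bsub>H\<^esub> = \<phi> x)
    \<longleftrightarrow> (\<exists>ws. length ws = n \<and> set ws \<subseteq> S \<and> foldr (mult G) ws \<one>\<^bsub>G\<^esub> = x)" (is "?l \<longleftrightarrow> ?r") for n
  proof
    assume ?l
    then obtain vs where vs: "length vs = n" "vs \<in> lists (\<phi> ` S)" "foldr (mult H) vs \<one>\<^bsub>H\<^esub> = \<phi> x"
      by auto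
    then obtain ws where ws: "ws \<in> lists S" "vs = map \<phi> ws" by (auto simp: lists_image)
    then have "set ws \<subseteq> carrier G" using S by auto
    then have "foldr (mult G) ws \<one>\<^bsub>G\<^esub> = x"
      using vs(3) ws(2) fold closed x inj by (metis inj_on_def)
    with ws vs(1) show ?r by (intro exI[of _ ws]) auto
  next
    assume ?r
    then obtain ws where "length ws = n" "set ws \<subseteq> S" "foldr (mult G) ws \<one>\<^bsub>G\<^esub> = x" by blast
    then show ?l using fold S by (intro exI[of _ "map \<phi> ws"]) auto
  qed
  then show ?thesis by (simp add: word_length_def)
qed

lemma bruhat_le_iso:
  assumes G: "group G" and H: "group H" and \<phi>: "\<phi> \<in> iso G H" and S: "S \<subseteq> carrier G"
    and xy: "x \<in> carrier G" "y \<in> carrier G"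
  shows "bruhat_le H (\<phi> ` S) (\<phi> x) (\<phi> y) \<longleftrightarrow> bruhat_le G S x y"
proof -
  interpret G: group G by fact
  interpret H: group H by fact
  interpret group_hom G H \<phi> using \<phi> by unfold_locales (auto simp: iso_def)
  have inj: "inj_on \<phi> (carrier G)" and surj: "\<phi> ` carrier G = carrier H"
    using \<phi> by (auto simp: iso_def bij_betw_def)
  have refl_carrier: "coxeter_reflections G S \<subseteq> carrier G"
    using S by (auto simp: coxeter_reflections_def)
  have refl: "coxeter_reflections H (\<phi> ` S) = \<phi> ` coxeter_reflections G S"
  proof -
    have conj: "\<phi> w \<otimes>\<^bsub>H\<^esub> \<phi> s \<otimes>\<^bsub>H\<^esub> inv\<^bsub>H\<^esub> \<phi> w = \<phi> (w \<otimes>\<^bsub>G\<^esub> s \<otimes>\<^bsub>G\<^esub> inv\<^bsub>G\<^esub> w)"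
      if "w \<in> carrier G" "s \<in> S" for w s
      using that S by (simp add: subset_iff)
    show ?thesis
    proof (intro equalityI subsetI)
      fix t assume "t \<in> coxeter_reflections H (\<phi> ` S)"
      then obtain h s where "h \<in> \<phi> ` carrier G" "s \<in> S" "t = h \<otimes>\<^bsub>H\<^esub> \<phi> s \<otimes>\<^bsub>H\<^esub> inv\<^bsub>H\<^esub> h"
        unfolding coxeter_reflections_def surj by blast
      then obtain w where w: "w \<in> carrier G" "t = \<phi> (w \<otimes>\<^bsub>G\<^esub> s \<otimes>\<^bsub>G\<^esub> inv\<^bsub>G\<^esub> w)"
        using conj by auto
      with \<open>s \<in> S\<close> show "t \<in> \<phi> ` coxeter_reflections G S"
        unfolding coxeter_reflections_def by blast
    next
      fix t assume "t \<in> \<phi> ` coxeter_reflections G S"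
      then obtain w s where w: "w \<in> carrier G" "s \<in> S" "t = \<phi> (w \<otimes>\<^bsub>G\<^esub> s \<otimes>\<^bsub>G\<^esub> inv\<^bsub>G\<^esub> w)"
        unfolding coxeter_reflections_def by blast
      then have "t = \<phi> w \<otimes>\<^bsub>H\<^esub> \<phi> s \<otimes>\<^bsub>H\<^esub> inv\<^bsub>H\<^esub> \<phi> w" "\<phi> w \<in> carrier H"
        using conj surj by auto
      with w(2) show "t \<in> coxeter_reflections H (\<phi> ` S)"
        unfolding coxeter_reflections_def by blast
    qed
  qed
  have step_iff: "bruhat_step H (\<phi> ` S) (\<phi> u) (\<phi> v) \<longleftrightarrow> bruhat_step G S u v"
    if uv: "u \<in> carrier G" "v \<in> carrier G" for u v
  proof -
    have "(\<exists>t\<in>coxeter_reflections H (\<phi> ` S). \<phi> v = \<phi> u \<otimes>\<^bsub>H\<^esub> t)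
      \<longleftrightarrow> (\<exists>t\<in>coxeter_reflections G S. v = u \<otimes>\<^bsub>G\<^esub> t)"
    proof -
      have "\<phi> v = \<phi> u \<otimes>\<^bsub>H\<^esub> \<phi> t \<longleftrightarrow> v = u \<otimes>\<^bsub>G\<^esub> t" if "t \<in> coxeter_reflections G S" for t
      proof -
        have t: "t \<in> carrier G" using that refl_carrier by blast
        then have "\<phi> u \<otimes>\<^bsub>H\<^esub> \<phi> t = \<phi> (u \<otimes>\<^bsub>G\<^esub> t)" using uv by simp
        then show ?thesis using inj_on_eq_iff[OF inj uv(2), of "u \<otimes>\<^bsub>G\<^esub> t"] uv t by simp
      qed
      then show ?thesis unfolding refl by blast
    qed
    then show ?thesis
      unfolding bruhat_step_def using uv word_length_iso[OF G H \<phi> S] by auto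
  qed
  show ?thesis
  proof
    assume "bruhat_le G S x y"
    then have "y \<in> carrier G \<and> bruhat_le H (\<phi> ` S) (\<phi> x) (\<phi> y)"
      unfolding bruhat_le_def
    proof (induction rule: rtranclp_induct)
      case base
      then show ?case using xy by simp
    next
      case (step u v)
      then have "v \<in> carrier G" using refl_carrier by (auto simp: bruhat_step_def)
      then show ?case using step step_iff
        by (meson rtranclp.rtrancl_into_rtrancl)
    qed
    then show "bruhat_le H (\<phi> ` S) (\<phi> x) (\<phi> y)" by blast
  next
    assume "bruhat_le H (\<phi> ` S) (\<phi> x) (\<phi> y)"
    \<comment> \<open>The intermediate elements of the chain are only known as elements of
      \<open>H\<close>, so a preimage of the current one is carried along.\<close>
    then have "\<exists>y'\<in>carrier G. \<phi> y' = \<phi> y \<and> bruhat_le G S x y'"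
      unfolding bruhat_le_def
    proof (induction rule: rtranclp_induct)
      case base
      then show ?case using xy by blast
    next
      case (step u v)
      then obtain u' where u': "u' \<in> carrier G" "\<phi> u' = u" "(bruhat_step G S)\<^sup>*\<^sup>* x u'" by blast
      have "v \<in> carrier H"
        using step(2) refl_carrier unfolding bruhat_step_def refl by auto
      then have "v \<in> \<phi> ` carrier G" unfolding surj .
      then obtain v' where v': "v' \<in> carrier G" "\<phi> v' = v" by (metis imageE)
      have "bruhat_step G S u' v'"
        using step(2) unfolding u'(2)[symmetric] v'(2)[symmetric] step_iff[OF u'(1) v'(1)] .
      then have "(bruhat_step G S)\<^sup>*\<^sup>* x v'"
        by (rule rtranclp.rtrancl_into_rtrancl[OF u'(3)])
      then show ?case using v' by blast
    qed
    then show "bruhat_le G S x y" using inj_onD[OF inj] xy(2) by blast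
  qed
qed

section \<open>Restriction of roots\<close>

lemma aa_inner_span:
  assumes "H \<in> aa \<Theta>" "s \<in> span \<Theta>"
  shows "s \<bullet> H = 0"
proof -
  have "orthogonal H s"
    using assms by (intro orthogonal_to_span[of s \<Theta>]) (auto simp: aa_def orthogonal_def inner_commute)
  then show ?thesis by (simp add: orthogonal_def inner_commute)
qed

lemma subspace_aa: "subspace (aa \<Theta>)"
  by (auto simp: subspace_def aa_def inner_add_right)

text \<open>This identifies \<open>res\<close> with the orthogonal projection along
  \<open>span \<Theta>\<close>. It is unique because the difference of two candidates is orthogonal
  to itself.\<close>

lemma res_eqI:
  assumes "z \<in> aa \<Theta>" "x - z \<in> span \<Theta>"
  shows "res \<Theta> x = z"
  unfolding res_def
proof (rule the_equality)
  have "x \<bullet> H = z \<bullet> H" if "H \<in> aa \<Theta>" for H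
    using aa_inner_span[OF that assms(2)] by (simp add: inner_diff_left)
  with assms(1) show "z \<in> aa \<Theta> \<and> (\<forall>H\<in>aa \<Theta>. z \<bullet> H = x \<bullet> H)" by simp
  fix v assume v: "v \<in> aa \<Theta> \<and> (\<forall>H\<in>aa \<Theta>. v \<bullet> H = x \<bullet> H)"
  then have "v - z \<in> aa \<Theta>" using assms(1) subspace_diff[OF subspace_aa] by blast
  then have "(v - z) \<bullet> (v - z) = 0"
    using v \<open>z \<in> aa \<Theta> \<and> (\<forall>H\<in>aa \<Theta>. z \<bullet> H = x \<bullet> H)\<close> by (simp add: inner_diff_left)
  then show "v = z" by simp
qed

lemma res_in_aa: "res \<Theta> x \<in> aa \<Theta>"
  and diff_res_in_span: "x - res \<Theta> x \<in> span \<Theta>"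
proof -
  obtain y z where yz: "y \<in> span \<Theta>" "\<And>w. w \<in> span \<Theta> \<Longrightarrow> orthogonal z w" "x = y + z"
    using orthogonal_subspace_decomp_exists[of \<Theta> x] by blast
  then have "z \<in> aa \<Theta>" by (auto simp: aa_def orthogonal_def inner_commute span_base)
  moreover have "x - z \<in> span \<Theta>" using yz by simp
  ultimately show "res \<Theta> x \<in> aa \<Theta>" "x - res \<Theta> x \<in> span \<Theta>" using res_eqI by metis+
qed

lemma linear_res: "linear (res \<Theta>)"
proof (rule linearI)
  fix x y :: 'a and c :: real
  have "x + y - (res \<Theta> x + res \<Theta> y) = (x - res \<Theta> x) + (y - res \<Theta> y)" by simp
  then have "x + y - (res \<Theta> x + res \<Theta> y) \<in> span \<Theta>"
    using span_add diff_res_in_span by metis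
  then show "res \<Theta> (x + y) = res \<Theta> x + res \<Theta> y"
    by (intro res_eqI subspace_add[OF subspace_aa] res_in_aa)
  have "c *\<^sub>R x - c *\<^sub>R res \<Theta> x = c *\<^sub>R (x - res \<Theta> x)" by (simp add: scaleR_diff_right)
  then have "c *\<^sub>R x - c *\<^sub>R res \<Theta> x \<in> span \<Theta>"
    using span_scale diff_res_in_span by metis
  then show "res \<Theta> (c *\<^sub>R x) = c *\<^sub>R res \<Theta> x"
    by (intro res_eqI subspace_scale[OF subspace_aa] res_in_aa)
qed

lemma res_of_aa: "v \<in> aa \<Theta> \<Longrightarrow> res \<Theta> v = v"
  by (rule res_eqI) (auto simp: span_zero)

lemma res_eq_0_iff: "res \<Theta> v = 0 \<longleftrightarrow> v \<in> span \<Theta>"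
  using diff_res_in_span[of v \<Theta>] res_eqI[of 0 \<Theta> v] subspace_aa[of \<Theta>]
  by (auto simp: subspace_0)

lemma res_inner: "H \<in> aa \<Theta> \<Longrightarrow> res \<Theta> v \<bullet> H = v \<bullet> H"
  using aa_inner_span[OF _ diff_res_in_span, of H \<Theta> v] by (simp add: inner_diff_left)

text \<open>An isometry that permutes \<open>\<Theta>\<close> preserves \<open>span \<Theta>\<close>
  and its orthogonal complement.\<close>

lemma res_comm:
  assumes "linear w" "\<And>u v. w u \<bullet> w v = u \<bullet> v" "w ` \<Theta> = \<Theta>"
  shows "res \<Theta> (w v) = w (res \<Theta> v)"
proof (rule res_eqI)
  show "w (res \<Theta> v) \<in> aa \<Theta>"
    unfolding aa_def
  proof (intro CollectI ballI)
    fix a assume "a \<in> \<Theta>"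
    then obtain b where "b \<in> \<Theta>" "a = w b" using assms(3) by blast
    then show "a \<bullet> w (res \<Theta> v) = 0" using res_in_aa[of \<Theta> v] assms(2) by (simp add: aa_def)
  qed
  have "w (v - res \<Theta> v) \<in> w ` span \<Theta>" using diff_res_in_span by blast
  also have "\<dots> = span \<Theta>" using span_linear_image[OF assms(1), of \<Theta>] assms(3) by simp
  finally show "w v - w (res \<Theta> v) \<in> span \<Theta>" using assms(1) by (simp add: linear_diff)
qed

locale parabolic_root_system = based_root_system R P \<xi>
  for R P :: "'a::euclidean_space set" and \<xi> :: 'a +
  fixes \<Theta> :: "'a set"
  assumes Theta_simple: "\<Theta> \<subseteq> simple_roots P"
begin

section \<open>Subsystems attached to \<open>\<Theta>\<close> and to a single root\<close>

abbreviation "rs \<equiv> res \<Theta>"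
abbreviation "\<sigma> \<equiv> sigma R P \<Theta>"
abbreviation "ru \<equiv> ru_Delta_pos R P \<Theta>"
abbreviation "W' \<equiv> carrier (W_prime R P \<Theta>)"

text \<open>This is the subspace spanned by \<open>\<Theta>\<close> and \<open>\<alpha>\<close>; as
  \<Delta>(\<alpha>) is its intersection with the root system, the results on subsystems
  apply.\<close>

definition line :: "'a \<Rightarrow> 'a set" where
  "line \<alpha> = {v. \<exists>c. rs v = c *\<^sub>R rs \<alpha>}"

lemma rs_simps [simp]:
  "rs (x + y) = rs x + rs y" "rs (x - y) = rs x - rs y" "rs (- x) = - rs x" "rs (c *\<^sub>R x) = c *\<^sub>R rs x"
  "rs 0 = 0" "rs (rs x) = rs x"
  using linear_res[of \<Theta>] res_of_aa[OF res_in_aa]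
  by (simp_all add: linear_add linear_diff linear_neg linear_cmul linear_0)

lemma subspace_line: "subspace (line \<alpha>)"
  unfolding subspace_def line_def
  by (auto simp flip: scaleR_left_distrib intro: exI[of _ "0::real"])

lemma self_in_line: "\<alpha> \<in> line \<alpha>"
  unfolding line_def by (auto intro: exI[of _ "1::real"])

lemma span_Theta_subset_line: "span \<Theta> \<subseteq> line \<alpha>"
  using res_eq_0_iff[of \<Theta>] unfolding line_def by (auto intro: exI[of _ "0::real"])

lemma Theta_subset_span: "\<Theta> \<subseteq> span \<Theta>"
  by (rule span_superset)

lemma Theta_subset_P: "\<Theta> \<subseteq> P"
  using Theta_simple B_subset by blast

lemma rs_Theta [simp]: "\<theta> \<in> \<Theta> \<Longrightarrow> rs \<theta> = 0"
  by (simp add: res_eq_0_iff span_base)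

lemma Delta_at_eq: "Delta_at R \<Theta> \<alpha> = R \<inter> line \<alpha>"
  by (auto simp: Delta_at_def line_def)

lemma Pi_at_eq: "Pi_at R P \<Theta> \<alpha> = simple_roots (P \<inter> line \<alpha>)"
proof -
  have "Delta_at R \<Theta> \<alpha> \<inter> P = P \<inter> line \<alpha>"
    unfolding Delta_at_eq using P_subset by blast
  then show ?thesis by (simp add: Pi_at_def)
qed

lemma line_cong: "rs \<alpha> = rs \<beta> \<Longrightarrow> line \<alpha> = line \<beta>"
  by (simp add: line_def)

lemma line_scale:
  assumes "rs \<alpha> = c *\<^sub>R rs \<beta>" "c \<noteq> 0"
  shows "line \<alpha> = line \<beta>"
proof -
  have "rs \<beta> = (1 / c) *\<^sub>R rs \<alpha>" using assms by simp
  then show ?thesis unfolding line_def using assms(1) by (metis scaleR_scaleR)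
qed

sublocale th: based_root_system "R \<inter> span \<Theta>" "P \<inter> span \<Theta>" \<xi>
  by (rule subsystem) (rule subspace_span)

text \<open>\<open>\<Theta>\<close> stays simple and already spans, so independence leaves no room
  for another simple root.\<close>

lemma th_simple: "simple_roots (P \<inter> span \<Theta>) = \<Theta>"
proof
  show sub: "\<Theta> \<subseteq> simple_roots (P \<inter> span \<Theta>)"
    using Theta_simple simple_in_subsystem Theta_subset_span by blast
  show "simple_roots (P \<inter> span \<Theta>) \<subseteq> \<Theta>"
  proof
    fix b assume b: "b \<in> simple_roots (P \<inter> span \<Theta>)"
    then have "b \<in> span \<Theta>" using th.B_subset by blast
    show "b \<in> \<Theta>"
    proof (rule ccontr)
      assume "b \<notin> \<Theta>"
      then have "\<Theta> \<subseteq> simple_roots (P \<inter> span \<Theta>) - {b}" using sub by blast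
      then have "b \<in> span (simple_roots (P \<inter> span \<Theta>) - {b})"
        using \<open>b \<in> span \<Theta>\<close> span_mono by blast
      then show False using th.independent_B b by (auto simp: dependent_def)
    qed
  qed
qed

text \<open>\<open>sigma\<close> refers to the group generated by \<open>\<Theta>\<close> alone;
  this makes the results on the subsystem \<open>R \<inter> span \<Theta>\<close> available for
  it.\<close>

lemma weyl_group_Theta: "weyl_group (R \<inter> span \<Theta>) = weyl_group \<Theta>"
  by (rule weyl_group_cong) (use th.weyl_simple in \<open>simp add: th_simple\<close>)

abbreviation "wT \<equiv> longest_element (weyl_group \<Theta>) (root_refl ` \<Theta>)"

lemma wT_eq: "wT = longest_element (weyl_group (R \<inter> span \<Theta>)) (root_refl ` simple_roots (P \<inter> span \<Theta>))"
  by (simp add: th_simple weyl_group_Theta)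

lemmas wT_weyl = th.w0_in_W[folded wT_eq]
lemmas wT_wT = th.w0_w0[folded wT_eq]

lemma wT_Theta: "\<theta> \<in> \<Theta> \<Longrightarrow> - wT \<theta> \<in> \<Theta>"
  using th.w0_simple by (simp add: th_simple weyl_group_Theta)

lemma weyl_th_subset: "weyl (R \<inter> span \<Theta>) \<subseteq> weyl (R \<inter> line \<alpha>)"
  using span_Theta_subset_line by (intro weyl_mono) blast

lemma weyl_line_subset: "weyl (R \<inter> line \<alpha>) \<subseteq> W"
  by (intro weyl_mono) blast

lemma rs_weyl_th:
  assumes "w \<in> weyl (R \<inter> span \<Theta>)"
  shows "rs (w v) = rs v"
  using assms
proof (induction arbitrary: v rule: weyl_induct)
  case (step a w)
  then have "rs a = 0" by (simp add: res_eq_0_iff)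
  then show ?case using step.IH by (simp add: root_refl_def)
qed simp

lemma weyl_th_fixes_aa:
  assumes "w \<in> weyl (R \<inter> span \<Theta>)" "H \<in> aa \<Theta>"
  shows "w H = H"
  using assms(1)
proof (induction rule: weyl_induct)
  case (step a w)
  then have "H \<bullet> a = 0" using aa_inner_span[OF assms(2), of a] by (simp add: inner_commute)
  then show ?case using step.IH by (simp add: root_refl_orthogonal)
qed simp

text \<open>A point in the relative interior of the face of the closed Weyl chamber cut out by
  \<open>\<Theta>\<close>. It later serves as the regular vector of the restricted roots.\<close>

definition \<omega> :: 'a where
  "\<omega> = (SOME \<omega>. \<forall>b\<in>B. b \<bullet> \<omega> = (if b \<in> \<Theta> then 0 else 1))"

lemma omega_simple: "b \<in> B \<Longrightarrow> b \<bullet> \<omega> = (if b \<in> \<Theta> then 0 else 1)"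
  using someI_ex[OF dual_vector[of "\<lambda>b. if b \<in> \<Theta> then 0 else 1"]] unfolding \<omega>_def by blast

lemma omega_in_aa: "\<omega> \<in> aa \<Theta>"
  using omega_simple Theta_simple by (auto simp: aa_def)

text \<open>The value at \<open>\<omega>\<close> is the sum of the coefficients outside
  \<open>\<Theta>\<close>; if it is 0, the root lies in \<open>span \<Theta>\<close>.\<close>

lemma rs_omega_pos:
  assumes "\<beta> \<in> P" "rs \<beta> \<noteq> 0"
  shows "rs \<beta> \<bullet> \<omega> > 0"
proof (rule ccontr)
  assume np: "\<not> rs \<beta> \<bullet> \<omega> > 0"
  obtain n :: "'a \<Rightarrow> nat" where n: "\<beta> = (\<Sum>b\<in>B. real (n b) *\<^sub>R b)"
    using positive_combination assms(1) by blast
  have "rs \<beta> \<bullet> \<omega> = \<beta> \<bullet> \<omega>" using res_inner[OF omega_in_aa] .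
  also have "\<dots> = (\<Sum>b\<in>B. real (n b) * (b \<bullet> \<omega>))"
    by (subst n) (simp add: inner_sum_left)
  finally have eq: "rs \<beta> \<bullet> \<omega> = (\<Sum>b\<in>B. real (n b) * (b \<bullet> \<omega>))" .
  have nn: "real (n b) * (b \<bullet> \<omega>) \<ge> 0" if "b \<in> B" for b using omega_simple[OF that] by simp
  then have "(\<Sum>b\<in>B. real (n b) * (b \<bullet> \<omega>)) \<ge> 0" by (rule sum_nonneg)
  then have "(\<Sum>b\<in>B. real (n b) * (b \<bullet> \<omega>)) = 0" using np eq by linarith
  then have z: "\<forall>b\<in>B. real (n b) * (b \<bullet> \<omega>) = 0"
    using nn finite_B by (subst (asm) sum_nonneg_eq_0_iff) auto
  have "real (n b) *\<^sub>R b \<in> span \<Theta>" if "b \<in> B" for b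
    using z omega_simple[OF that] that by (cases "b \<in> \<Theta>") (auto simp: span_base span_scale span_zero)
  then have "\<beta> \<in> span \<Theta>" unfolding n by (rule span_sum)
  then show False using assms(2) by (simp add: res_eq_0_iff)
qed

lemma pos_iff_rs_omega:
  assumes "\<beta> \<in> R" "rs \<beta> \<noteq> 0"
  shows "\<beta> \<in> P \<longleftrightarrow> rs \<beta> \<bullet> \<omega> > 0"
  using rs_omega_pos[of \<beta>] rs_omega_pos[of "- \<beta>"] notin_P_iff[OF assms(1)] assms(2) by fastforce

text \<open>Modulo \<open>span \<Theta>\<close> the subspace \<open>line \<alpha>\<close> is
  one-dimensional, so two simple roots outside \<open>\<Theta>\<close> would contradict
  independence. With none, every root of the subsystem, \<open>\<alpha>\<close> included, would
  restrict to 0.\<close>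

lemma Pi_at_structure:
  assumes "\<alpha> \<in> R" "rs \<alpha> \<noteq> 0"
  shows "\<exists>b. b \<notin> \<Theta> \<and> Pi_at R P \<Theta> \<alpha> = \<Theta> \<union> {b}"
proof -
  interpret l: based_root_system "R \<inter> line \<alpha>" "P \<inter> line \<alpha>" \<xi>
    by (rule subsystem) (rule subspace_line)
  have sub: "\<Theta> \<subseteq> l.B"
    using Theta_simple simple_in_subsystem Theta_subset_span span_Theta_subset_line by blast
  have notspan: "b \<notin> span (l.B - {b})" if "b \<in> l.B" for b
    using l.independent_B that by (auto simp: dependent_def)
  have rs_nz: "rs b \<noteq> 0" if "b \<in> l.B - \<Theta>" for b
  proof
    assume "rs b = 0"
    then have "b \<in> span \<Theta>" by (simp add: res_eq_0_iff)
    moreover have "\<Theta> \<subseteq> l.B - {b}" using sub that by blast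
    ultimately show False using notspan[of b] that span_mono by blast
  qed
  have unique: "b = c" if b: "b \<in> l.B - \<Theta>" and c: "c \<in> l.B - \<Theta>" for b c
  proof (rule ccontr)
    assume "b \<noteq> c"
    obtain s t where st: "rs b = s *\<^sub>R rs \<alpha>" "rs c = t *\<^sub>R rs \<alpha>"
      using b c l.B_subset unfolding line_def by blast
    then have "t \<noteq> 0" using rs_nz[OF c] by auto
    have "rs (b - (s / t) *\<^sub>R c) = 0" using st \<open>t \<noteq> 0\<close> by simp
    then have "b - (s / t) *\<^sub>R c \<in> span \<Theta>" by (simp only: res_eq_0_iff)
    moreover have "\<Theta> \<subseteq> l.B - {b}" using sub b by blast
    ultimately have "b - (s / t) *\<^sub>R c \<in> span (l.B - {b})" using span_mono by blast
    moreover have "(s / t) *\<^sub>R c \<in> span (l.B - {b})"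
      using c \<open>b \<noteq> c\<close> by (intro span_scale span_base) auto
    ultimately have "b \<in> span (l.B - {b})" using span_add by fastforce
    then show False using notspan b by blast
  qed
  have "l.B \<noteq> \<Theta>"
  proof
    assume eq: "l.B = \<Theta>"
    have "rs \<beta> = 0" if "\<beta> \<in> P \<inter> line \<alpha>" for \<beta>
    proof -
      obtain n :: "'a \<Rightarrow> nat" where "\<beta> = (\<Sum>b\<in>l.B. real (n b) *\<^sub>R b)"
        using l.positive_combination[OF \<open>\<beta> \<in> P \<inter> line \<alpha>\<close>] by blast
      then have "\<beta> \<in> span \<Theta>" unfolding eq by (simp add: span_sum span_scale span_base)
      then show ?thesis by (simp add: res_eq_0_iff)
    qed
    moreover have "\<alpha> \<in> P \<inter> line \<alpha> \<or> - \<alpha> \<in> P \<inter> line \<alpha>"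
      using assms(1) notin_P_iff self_in_line subspace_line subspace_neg by blast
    ultimately show False using assms(2) by fastforce
  qed
  then obtain b where "b \<in> l.B - \<Theta>" using sub by blast
  then have "b \<notin> \<Theta>" "l.B = \<Theta> \<union> {b}" using unique sub by blast+
  then show ?thesis unfolding Pi_at_eq by blast
qed

lemma reducedD:
  assumes "\<alpha> \<in> R" "reduced R P \<Theta> \<alpha>"
  shows "\<alpha> \<notin> \<Theta>" "Pi_at R P \<Theta> \<alpha> = \<Theta> \<union> {\<alpha>}" "rs \<alpha> \<noteq> 0"
proof -
  show nz: "rs \<alpha> \<noteq> 0" using assms(2) by (simp add: reduced_def)
  obtain b where b: "b \<notin> \<Theta> \<and> Pi_at R P \<Theta> \<alpha> = \<Theta> \<union> {b}"
    using Pi_at_structure[OF assms(1) nz] by blast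
  have "tilde R P \<Theta> \<alpha> = b" unfolding tilde_def using b by (intro the_equality) auto
  then have "\<alpha> = b" using assms(2) by (simp add: reduced_def)
  then show "\<alpha> \<notin> \<Theta>" "Pi_at R P \<Theta> \<alpha> = \<Theta> \<union> {\<alpha>}" using b by auto
qed

lemma reducedI:
  assumes "\<alpha> \<notin> \<Theta>" "Pi_at R P \<Theta> \<alpha> = \<Theta> \<union> {\<alpha>}" "rs \<alpha> \<noteq> 0"
  shows "reduced R P \<Theta> \<alpha>"
proof -
  have "tilde R P \<Theta> \<alpha> = \<alpha>" unfolding tilde_def using assms by (intro the_equality) auto
  then show ?thesis using assms(3) by (simp add: reduced_def)
qed

section \<open>The elements \<open>sigma\<close> and their action on \<open>\<Theta>\<close> and
  \<open>aa \<Theta>\<close>\<close>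

definition wl :: "'a \<Rightarrow> 'a \<Rightarrow> 'a" where
  "wl \<alpha> = longest_element (weyl_group (R \<inter> line \<alpha>)) (root_refl ` simple_roots (P \<inter> line \<alpha>))"

lemma line_system: "based_root_system (R \<inter> line \<alpha>) (P \<inter> line \<alpha>) \<xi>"
  by (rule subsystem) (rule subspace_line)

lemmas wl_weyl = based_root_system.w0_in_W[OF line_system, folded wl_def]
lemmas wl_wl = based_root_system.w0_w0[OF line_system, folded wl_def]
lemmas wl_simple = based_root_system.w0_simple[OF line_system, folded wl_def]

lemma sigma_eq: "\<sigma> \<alpha> = wl \<alpha> \<circ> wT"
  using weyl_bij[OF wl_weyl] weyl_bij[OF wT_weyl]
  by (simp add: sigma_def Delta_at_eq Pi_at_eq wl_def mult_weyl_group)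

lemma sigma_weyl: "\<sigma> \<alpha> \<in> weyl (R \<inter> line \<alpha>)"
  unfolding sigma_eq using wT_weyl weyl_th_subset by (intro weyl_comp wl_weyl) blast

lemma sigma_in_W: "\<sigma> \<alpha> \<in> W"
  using sigma_weyl weyl_line_subset by blast

lemma useful_iff: "useful R P \<Theta> \<alpha> \<longleftrightarrow> \<sigma> \<alpha> \<circ> \<sigma> \<alpha> = id \<and> \<sigma> \<alpha> \<noteq> id"
  unfolding useful_def using group.ord_2_iff[OF group_weyl_group, of "\<sigma> \<alpha>" R] sigma_in_W[of \<alpha>]
  by (simp add: carrier_weyl_group mult_weyl_group weyl_bij one_weyl_group)

lemma ruD:
  assumes "\<alpha> \<in> ru"
  shows "\<alpha> \<in> P" "\<alpha> \<in> R" "\<alpha> \<notin> \<Theta>" "rs \<alpha> \<noteq> 0"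
    "simple_roots (P \<inter> line \<alpha>) = \<Theta> \<union> {\<alpha>}" "\<sigma> \<alpha> \<circ> \<sigma> \<alpha> = id" "\<sigma> \<alpha> \<noteq> id"
proof -
  show P: "\<alpha> \<in> P" "\<alpha> \<in> R" using assms P_subset by (auto simp: ru_Delta_pos_def)
  have "reduced R P \<Theta> \<alpha>" using assms by (simp add: ru_Delta_pos_def)
  from reducedD[OF P(2) this]
  show "\<alpha> \<notin> \<Theta>" "rs \<alpha> \<noteq> 0" "simple_roots (P \<inter> line \<alpha>) = \<Theta> \<union> {\<alpha>}"
    by (simp_all add: Pi_at_eq)
  show "\<sigma> \<alpha> \<circ> \<sigma> \<alpha> = id" "\<sigma> \<alpha> \<noteq> id"
    using assms by (simp_all add: ru_Delta_pos_def useful_iff)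
qed

lemma ruI:
  assumes "\<alpha> \<in> P" "\<alpha> \<notin> \<Theta>" "rs \<alpha> \<noteq> 0" "simple_roots (P \<inter> line \<alpha>) = \<Theta> \<union> {\<alpha>}"
    "\<sigma> \<alpha> \<circ> \<sigma> \<alpha> = id" "\<sigma> \<alpha> \<noteq> id"
  shows "\<alpha> \<in> ru"
  using assms reducedI[of \<alpha>] by (simp add: ru_Delta_pos_def useful_iff Pi_at_eq)

text \<open>Usefulness makes the product of these two involutions an involution, hence they
  commute.\<close>

lemma wl_wT_commute:
  assumes "\<alpha> \<in> ru"
  shows "wl \<alpha> \<circ> wT = wT \<circ> wl \<alpha>"
proof (rule ext)
  fix v
  have a: "wl \<alpha> (wl \<alpha> x) = x" "wT (wT x) = x" for x
    using fun_cong[OF wl_wl[of \<alpha>], of x] fun_cong[OF wT_wT, of x] by simp_all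
  have "wl \<alpha> (wT (wl \<alpha> (wT x))) = x" for x
    using fun_cong[OF ruD(6)[OF assms], of x] by (simp add: sigma_eq)
  from this[of "wT (wl \<alpha> v)"] show "(wl \<alpha> \<circ> wT) v = (wT \<circ> wl \<alpha>) v" by (simp add: a)
qed

text \<open>\<open>- wl \<alpha>\<close> permutes \<open>\<Theta> \<union> {\<alpha>}\<close>, and
  usefulness keeps the two parts apart. If it sent a member of \<open>\<Theta>\<close> to
  \<open>\<alpha>\<close>, commutation would put \<open>- wT \<alpha>\<close> into this base; but
  \<open>wT\<close> does not change restrictions, so the value of that root at
  \<open>\<omega>\<close> would be negative.\<close>

lemma wl_ru:
  assumes "\<alpha> \<in> ru"
  shows "\<theta> \<in> \<Theta> \<Longrightarrow> - wl \<alpha> \<theta> \<in> \<Theta>" and "wl \<alpha> \<alpha> = - \<alpha>"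
proof -
  note ru = ruD[OF assms]
  have wl_l: "linear (wl \<alpha>)" and wT_l: "linear wT"
    using weyl_linear wl_weyl wT_weyl by blast+
  have simple: "- wl \<alpha> b \<in> \<Theta> \<union> {\<alpha>}" if "b \<in> \<Theta> \<union> {\<alpha>}" for b
    using wl_simple[of b \<alpha>] that unfolding ru(5) .
  have Th: "- wl \<alpha> \<theta> \<in> \<Theta>" if th: "\<theta> \<in> \<Theta>" for \<theta>
  proof (rule ccontr)
    assume "- wl \<alpha> \<theta> \<notin> \<Theta>"
    then have "- wl \<alpha> \<theta> = \<alpha>" using simple th by blast
    then have eq: "wl \<alpha> \<theta> = - \<alpha>" by (metis minus_minus)
    have "wl \<alpha> (- wT \<theta>) = - (wT \<circ> wl \<alpha>) \<theta>"
      using fun_cong[OF wl_wT_commute[OF assms], of \<theta>] wl_l by (simp add: linear_neg)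
    also have "\<dots> = wT \<alpha>" using wT_l by (simp add: eq linear_neg)
    finally have "- wT \<alpha> \<in> \<Theta> \<union> {\<alpha>}" using simple[of "- wT \<theta>"] wT_Theta[OF th] by simp
    moreover have "rs x \<bullet> \<omega> \<ge> 0" if "x \<in> \<Theta> \<union> {\<alpha>}" for x
      using that rs_omega_pos[OF ru(1) ru(4)] by auto
    ultimately have "rs (- wT \<alpha>) \<bullet> \<omega> \<ge> 0" by blast
    then show False using rs_weyl_th[OF wT_weyl, of \<alpha>] rs_omega_pos[OF ru(1) ru(4)] by simp
  qed
  then show "\<theta> \<in> \<Theta> \<Longrightarrow> - wl \<alpha> \<theta> \<in> \<Theta>" .
  have "- wl \<alpha> \<alpha> \<in> \<Theta> \<union> {\<alpha>}" using simple by blast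
  moreover have "- wl \<alpha> \<alpha> \<notin> \<Theta>"
  proof
    assume "- wl \<alpha> \<alpha> \<in> \<Theta>"
    from Th[OF this] have "wl \<alpha> (wl \<alpha> \<alpha>) \<in> \<Theta>" using wl_l by (simp add: linear_neg)
    then show False using ru(3) fun_cong[OF wl_wl[of \<alpha>], of \<alpha>] by simp
  qed
  ultimately have "- wl \<alpha> \<alpha> = \<alpha>" by blast
  then show "wl \<alpha> \<alpha> = - \<alpha>" by (metis minus_minus)
qed

text \<open>Both \<open>- wT\<close> and \<open>- wl \<alpha>\<close> map \<open>\<Theta>\<close> to
  itself, and the signs cancel.\<close>

lemma sigma_Theta:
  assumes "\<alpha> \<in> ru"
  shows "\<sigma> \<alpha> ` \<Theta> = \<Theta>"
proof
  have l: "linear (wl \<alpha>)" using weyl_linear wl_weyl by blast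
  show sub: "\<sigma> \<alpha> ` \<Theta> \<subseteq> \<Theta>"
  proof
    fix x assume "x \<in> \<sigma> \<alpha> ` \<Theta>"
    then obtain \<theta> where \<theta>: "\<theta> \<in> \<Theta>" "x = \<sigma> \<alpha> \<theta>" by blast
    then have "x = - wl \<alpha> (- wT \<theta>)" using l by (simp add: sigma_eq linear_neg)
    then show "x \<in> \<Theta>" using wl_ru(1)[OF assms wT_Theta[OF \<theta>(1)]] by simp
  qed
  show "\<Theta> \<subseteq> \<sigma> \<alpha> ` \<Theta>"
  proof
    fix \<theta> assume "\<theta> \<in> \<Theta>"
    moreover have "\<theta> = \<sigma> \<alpha> (\<sigma> \<alpha> \<theta>)" using fun_cong[OF ruD(6)[OF assms], of \<theta>] by simp
    ultimately show "\<theta> \<in> \<sigma> \<alpha> ` \<Theta>" using sub by blast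
  qed
qed

text \<open>\<open>wT\<close> fixes \<open>H\<close>. The isometry \<open>wl \<alpha>\<close>
  preserves \<open>aa \<Theta>\<close>, moves \<open>H\<close> inside \<open>line \<alpha>\<close>,
  hence by a multiple of \<open>rs \<alpha>\<close>, and negates \<open>rs \<alpha>\<close>.\<close>

lemma sigma_on_aa:
  assumes "\<alpha> \<in> ru" "H \<in> aa \<Theta>"
  shows "\<sigma> \<alpha> H = root_refl (rs \<alpha>) H"
proof -
  note ru = ruD[OF assms(1)]
  have l: "linear (wl \<alpha>)" using weyl_linear wl_weyl by blast
  have inner: "wl \<alpha> u \<bullet> wl \<alpha> v = u \<bullet> v" for u v using weyl_inner wl_weyl by blast
  have inv: "wl \<alpha> (wl \<alpha> v) = v" for v using fun_cong[OF wl_wl[of \<alpha>], of v] by simp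
  have aa: "wl \<alpha> K \<in> aa \<Theta>" if "K \<in> aa \<Theta>" for K
    unfolding aa_def
  proof (intro CollectI ballI)
    fix \<theta> assume "\<theta> \<in> \<Theta>"
    have "\<theta> \<bullet> wl \<alpha> K = wl \<alpha> \<theta> \<bullet> K" using inner[of "wl \<alpha> \<theta>" K] by (simp add: inv)
    also have "\<dots> = - ((- wl \<alpha> \<theta>) \<bullet> K)" by simp
    also have "(- wl \<alpha> \<theta>) \<bullet> K = 0"
      using wl_ru(1)[OF assms(1) \<open>\<theta> \<in> \<Theta>\<close>] that unfolding aa_def by blast
    finally show "\<theta> \<bullet> wl \<alpha> K = 0" by simp
  qed
  have "wl \<alpha> (rs \<alpha>) = - rs \<alpha>"
  proof -
    have "wl \<alpha> (\<alpha> - rs \<alpha>) \<in> span \<Theta>"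
    proof -
      have "wl \<alpha> ` \<Theta> \<subseteq> span \<Theta>"
        using wl_ru(1)[OF assms(1)] span_base span_neg by fastforce
      then have "wl \<alpha> ` span \<Theta> \<subseteq> span \<Theta>"
        by (metis span_linear_image[OF l] span_minimal subspace_span)
      then show ?thesis using diff_res_in_span by blast
    qed
    then have "rs (wl \<alpha> (\<alpha> - rs \<alpha>)) = 0" by (simp add: res_eq_0_iff)
    then have "rs (wl \<alpha> \<alpha>) = rs (wl \<alpha> (rs \<alpha>))" using l by (simp add: linear_diff)
    then show ?thesis
      using res_of_aa[OF aa[OF res_in_aa]] wl_ru(2)[OF assms(1)] by simp
  qed
  have diff: "wl \<alpha> H - H \<in> line \<alpha>"
    using weyl_diff_in_subspace[OF subspace_line wl_weyl] .
  then obtain c where c: "rs (wl \<alpha> H - H) = c *\<^sub>R rs \<alpha>" unfolding line_def by blast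
  have "wl \<alpha> H - H \<in> aa \<Theta>" using aa assms(2) subspace_diff[OF subspace_aa] by blast
  then have H: "wl \<alpha> H = H + c *\<^sub>R rs \<alpha>" using c res_of_aa by (metis add_diff_cancel_left' diff_add_cancel add.commute)
  \<comment> \<open>Pairing with \<open>rs \<alpha>\<close> determines the multiple
    \<open>c\<close>.\<close>
  have "wl \<alpha> H \<bullet> rs \<alpha> = - (H \<bullet> rs \<alpha>)"
    using inner[of H "rs \<alpha>"] \<open>wl \<alpha> (rs \<alpha>) = - rs \<alpha>\<close> by simp
  then have "H \<bullet> rs \<alpha> + c * (rs \<alpha> \<bullet> rs \<alpha>) = - (H \<bullet> rs \<alpha>)"
    unfolding H by (simp add: inner_add_left)
  then have "c = - (2 * (H \<bullet> rs \<alpha>) / (rs \<alpha> \<bullet> rs \<alpha>))"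
    using ru(4) by (simp add: field_simps)
  then have "wl \<alpha> H = root_refl (rs \<alpha>) H" unfolding H by (simp add: root_refl_def)
  then show ?thesis
    using weyl_th_fixes_aa[OF wT_weyl assms(2)] by (simp add: sigma_eq)
qed

section \<open>The group generated by the useful \<open>sigma\<close>\<close>

lemma W'_induct [consumes 1, case_names id sigma comp]:
  assumes "w \<in> W'" "Q id" "\<And>\<alpha>. \<alpha> \<in> ru \<Longrightarrow> Q (\<sigma> \<alpha>)"
    "\<And>v w. v \<in> W' \<Longrightarrow> w \<in> W' \<Longrightarrow> v \<in> W \<Longrightarrow> w \<in> W \<Longrightarrow> Q v \<Longrightarrow> Q w \<Longrightarrow> Q (v \<circ> w)"
  shows "Q w"
proof -
  have "w \<in> generate (weyl_group R) (\<sigma> ` ru)" using assms(1) by (simp add: W_prime_def)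
  then have "w \<in> W \<and> Q w"
  proof (induction rule: generate.induct)
    case one
    then show ?case using assms(2) by (simp only: one_weyl_group id_in_weyl)
  next
    case (incl h)
    then show ?case using assms(3) sigma_in_W by blast
  next
    case (inv h)
    then obtain \<alpha> where \<alpha>: "\<alpha> \<in> ru" "h = \<sigma> \<alpha>" by blast
    \<comment> \<open>A generator is its own inverse, so the rule needs no case for
      inverses.\<close>
    have "inv_fun (\<sigma> \<alpha>) = \<sigma> \<alpha>"
      using ruD(6)[OF \<alpha>(1)] inv_unique_comp by blast
    then have "inv\<^bsub>weyl_group R\<^esub> h = \<sigma> \<alpha>"
      using inv_weyl_group[OF sigma_in_W] \<alpha>(2) by simp
    then show ?case using assms(3)[OF \<alpha>(1)] sigma_in_W by simp
  next
    case (eng v w)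
    then have "v \<in> W'" "w \<in> W'" by (simp_all add: W_prime_def)
    then have "Q (v \<circ> w)" "v \<circ> w \<in> W" using eng assms(4) weyl_comp by blast+
    then show ?case using eng mult_weyl_group[OF weyl_bij weyl_bij] by metis
  qed
  then show ?thesis by blast
qed

lemma W'_subset: "w \<in> W' \<Longrightarrow> w \<in> W"
  by (induction rule: W'_induct) (simp_all only: id_in_weyl sigma_in_W weyl_comp)

lemma id_in_W': "id \<in> W'"
  using generate.one[of "weyl_group R" "\<sigma> ` ru"] unfolding W_prime_def one_weyl_group by simp

lemma sigma_in_W': "\<alpha> \<in> ru \<Longrightarrow> \<sigma> \<alpha> \<in> W'"
  unfolding W_prime_def by (simp add: generate.incl)

lemma comp_in_W':
  assumes "v \<in> W'" "w \<in> W'"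
  shows "v \<circ> w \<in> W'"
proof -
  have "v \<otimes>\<^bsub>weyl_group R\<^esub> w \<in> W'"
    using assms generate.eng[of v "weyl_group R" "\<sigma> ` ru" w] by (simp add: W_prime_def)
  then show ?thesis
    using mult_weyl_group[OF weyl_bij weyl_bij] assms[THEN W'_subset] by metis
qed

lemma W'_Theta: "w \<in> W' \<Longrightarrow> w ` \<Theta> = \<Theta>"
proof (induction rule: W'_induct)
  case id
  show ?case by auto
next
  case (comp v w)
  then show ?case by (metis image_comp)
qed (rule sigma_Theta)

lemma rs_W': "w \<in> W' \<Longrightarrow> rs (w v) = w (rs v)"
  using W'_subset W'_Theta by (intro res_comm weyl_linear weyl_inner) auto

lemma W'_inj_zero: "w \<in> W' \<Longrightarrow> w v = 0 \<Longrightarrow> v = 0"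
  using weyl_inner[OF W'_subset, of w v v] by simp

lemma W'_line:
  assumes "w \<in> W'"
  shows "w v \<in> line (w \<beta>) \<longleftrightarrow> v \<in> line \<beta>"
proof -
  have l: "linear w" using weyl_linear W'_subset assms by blast
  have "rs (w v) = c *\<^sub>R rs (w \<beta>) \<longleftrightarrow> rs v = c *\<^sub>R rs \<beta>" for c
  proof -
    have "rs (w v) - c *\<^sub>R rs (w \<beta>) = w (rs v - c *\<^sub>R rs \<beta>)"
      using l by (simp add: rs_W'[OF assms] linear_diff linear_cmul)
    moreover have "w (rs v - c *\<^sub>R rs \<beta>) = 0 \<longleftrightarrow> rs v - c *\<^sub>R rs \<beta> = 0"
      using W'_inj_zero[OF assms] linear_0[OF l] by metis
    ultimately show ?thesis by (metis right_minus_eq)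
  qed
  then show ?thesis by (simp add: line_def)
qed

lemma W'_span:
  assumes "w \<in> W'"
  shows "w v \<in> span \<Theta> \<longleftrightarrow> v \<in> span \<Theta>"
  using W'_inj_zero[OF assms, of "rs v"] linear_0[OF weyl_linear[OF W'_subset[OF assms]]]
  by (metis res_eq_0_iff rs_W'[OF assms])

text \<open>Conjugation by \<open>w\<close> carries the base, \<open>wl\<close> and
  \<open>wT\<close> belonging to \<open>\<beta>\<close> to those belonging to
  \<open>w \<beta>\<close>, hence also the involution \<open>\<sigma> \<beta>\<close>.\<close>

lemma W'_ru:
  assumes w: "w \<in> W'" and \<beta>: "\<beta> \<in> ru" and pos: "w \<beta> \<in> P"
  shows "w \<beta> \<in> ru"
proof -
  note ru = ruD[OF \<beta>]
  have wW: "w \<in> W" using w W'_subset by blast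
  have l: "linear w" and inj: "inj w" using weyl_linear weyl_bij wW bij_is_inj by blast+
  have ThP: "w \<theta> \<in> \<Theta>" if "\<theta> \<in> \<Theta>" for \<theta> using W'_Theta[OF w] that by blast
  have im: "w ` (P \<inter> line \<beta>) = P \<inter> line (w \<beta>)"
    by (rule image_pos_subsystem[OF subspace_line subspace_line wW W'_line[OF w]])
      (use ru(5) pos ThP Theta_subset_P in auto)
  have imT: "w ` (P \<inter> span \<Theta>) = P \<inter> span \<Theta>"
    by (rule image_pos_subsystem[OF subspace_span subspace_span wW W'_span[OF w]])
      (use ThP Theta_subset_P in \<open>auto simp: th_simple\<close>)
  have simple: "simple_roots (P \<inter> line (w \<beta>)) = \<Theta> \<union> {w \<beta>}"
    unfolding im[symmetric] simple_roots_image[OF l inj] ru(5) using W'_Theta[OF w] by auto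
  have nz: "rs (w \<beta>) \<noteq> 0" using rs_W'[OF w] W'_inj_zero[OF w] ru(4) by metis
  then have nTh: "w \<beta> \<notin> \<Theta>" using rs_Theta by blast
  have wl: "wl (w \<beta>) \<circ> w = w \<circ> wl \<beta>"
    unfolding wl_def by (rule longest_conj[OF subspace_line subspace_line wW im])
  have wT: "wT \<circ> w = w \<circ> wT"
    unfolding wT_eq by (rule longest_conj[OF subspace_span subspace_span wW imT])
  have \<sigma>: "\<sigma> (w \<beta>) \<circ> w = w \<circ> \<sigma> \<beta>"
    unfolding sigma_eq using wl wT by (metis comp_assoc)
  then have eq: "\<sigma> (w \<beta>) = w \<circ> \<sigma> \<beta> \<circ> inv_fun w"
    using weyl_inv_comp(2)[OF wW] by (metis comp_assoc comp_id)
  have "\<sigma> (w \<beta>) \<circ> \<sigma> (w \<beta>) = w \<circ> (\<sigma> \<beta> \<circ> \<sigma> \<beta>) \<circ> inv_fun w"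
    using \<sigma> eq by (metis comp_assoc)
  then have invol: "\<sigma> (w \<beta>) \<circ> \<sigma> (w \<beta>) = id"
    using ru(6) weyl_inv_comp(2)[OF wW] by (metis comp_id)
  have "\<sigma> (w \<beta>) \<noteq> id"
  proof
    assume "\<sigma> (w \<beta>) = id"
    then have "w = w \<circ> \<sigma> \<beta>" using \<sigma> by (metis id_comp)
    then have "inv_fun w \<circ> w = inv_fun w \<circ> w \<circ> \<sigma> \<beta>" by (metis comp_assoc)
    then show False using ru(7) weyl_inv_comp(1)[OF wW] by (metis id_comp)
  qed
  then show ?thesis using ruI pos nTh nz simple invol by blast
qed

lemma rs_sigma_self: "\<alpha> \<in> ru \<Longrightarrow> \<sigma> \<alpha> (rs \<alpha>) = - rs \<alpha>"
  by (simp add: sigma_on_aa[OF _ res_in_aa])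

section \<open>The restricted root system\<close>

abbreviation "Sp \<equiv> ru_Sigma_pos R P \<Theta>"

definition RS :: "'a set" where
  "RS = Sp \<union> uminus ` Sp"

lemma W'_RS:
  assumes "w \<in> W'" "\<gamma> \<in> RS"
  shows "w \<gamma> \<in> RS"
proof -
  have l: "linear w" using weyl_linear W'_subset assms by blast
  have ru: "w (rs \<beta>) \<in> RS" if \<beta>: "\<beta> \<in> ru" for \<beta>
  proof (cases "w \<beta> \<in> P")
    case True
    then have "rs (w \<beta>) \<in> Sp" using W'_ru[OF assms(1) \<beta>] by (simp add: ru_Sigma_pos_def)
    then show ?thesis using rs_W'[OF assms(1)] by (simp add: RS_def)
  next
    case False
    \<comment> \<open>\<open>- w \<beta>\<close> has the right restriction but may fail to be
      reduced; \<open>?w \<beta>\<close> has the same restriction and is covered by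
      \<open>W'_ru\<close>.\<close>
    let ?w = "w \<circ> \<sigma> \<beta>"
    have w: "?w \<in> W'" by (intro comp_in_W' assms(1) sigma_in_W' \<beta>)
    have rs: "rs (?w \<beta>) = - rs (w \<beta>)"
      using rs_W'[OF w, of \<beta>] rs_sigma_self[OF \<beta>] l rs_W'[OF assms(1), of \<beta>] by (simp add: linear_neg)
    have R: "w \<beta> \<in> R" "?w \<beta> \<in> R" using weyl_in_R W'_subset assms(1) w ruD(2)[OF \<beta>] by blast+
    have nz: "rs (w \<beta>) \<noteq> 0" using rs_W'[OF assms(1)] W'_inj_zero[OF assms(1)] ruD(4)[OF \<beta>] by metis
    have "- w \<beta> \<in> P" using False R notin_P_iff by blast
    then have "rs (?w \<beta>) \<bullet> \<omega> > 0" using rs_omega_pos[of "- w \<beta>"] nz rs by simp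
    then have "?w \<beta> \<in> P" using pos_iff_rs_omega[OF R(2)] rs nz by fastforce
    then have "rs (?w \<beta>) \<in> Sp" using W'_ru[OF w \<beta>] by (simp add: ru_Sigma_pos_def)
    then have "- w (rs \<beta>) \<in> Sp" using rs rs_W'[OF assms(1)] by metis
    then have "- (- w (rs \<beta>)) \<in> uminus ` Sp" by (rule imageI)
    then show ?thesis by (simp add: RS_def)
  qed
  consider \<beta> where "\<beta> \<in> ru" "\<gamma> = rs \<beta>" | \<beta> where "\<beta> \<in> ru" "\<gamma> = - rs \<beta>"
    using assms(2) unfolding RS_def ru_Sigma_pos_def by blast
  then show ?thesis
  proof cases
    case 1
    then show ?thesis using ru by simp
  next
    case 2
    then have "w \<gamma> = - w (rs \<beta>)" using l by (simp add: linear_neg)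
    moreover have "w (rs \<beta>) \<in> RS" using ru 2 by blast
    ultimately show ?thesis unfolding RS_def by force
  qed
qed

text \<open>Coefficients in the base \<open>\<Theta> \<union> {\<alpha>}\<close> are integers, and
  restriction keeps only that of \<open>\<alpha>\<close>.\<close>

lemma rs_line_integral:
  assumes "\<alpha> \<in> ru" "d \<in> R \<inter> line \<alpha>"
  shows "\<exists>k::int. rs d = of_int k *\<^sub>R rs \<alpha>"
proof -
  interpret l: based_root_system "R \<inter> line \<alpha>" "P \<inter> line \<alpha>" \<xi> by (rule line_system)
  have pos: "\<exists>k::int. rs a = of_int k *\<^sub>R rs \<alpha>" if "a \<in> P \<inter> line \<alpha>" for a
  proof -
    obtain n :: "'a \<Rightarrow> nat" where "a = (\<Sum>b\<in>l.B. real (n b) *\<^sub>R b)"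
      using l.positive_combination[OF \<open>a \<in> P \<inter> line \<alpha>\<close>] by blast
    then have "rs a = (\<Sum>b\<in>l.B. real (n b) *\<^sub>R rs b)"
      using linear_res[of \<Theta>] by (simp add: linear_sum linear_cmul)
    also have "\<dots> = (\<Sum>b\<in>{\<alpha>}. real (n b) *\<^sub>R rs b)"
      using ruD(5)[OF assms(1)] l.finite_B by (intro sum.mono_neutral_right) auto
    finally have "rs a = of_int (int (n \<alpha>)) *\<^sub>R rs \<alpha>" by simp
    then show ?thesis by blast
  qed
  show ?thesis
  proof (cases "d \<in> P \<inter> line \<alpha>")
    case True
    then show ?thesis by (rule pos)
  next
    case False
    then have "- d \<in> P \<inter> line \<alpha>" using assms(2) l.notin_P_iff by blast
    then obtain k :: int where "rs (- d) = of_int k *\<^sub>R rs \<alpha>" using pos by blast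
    then have "rs d = of_int (- k) *\<^sub>R rs \<alpha>" by (simp add: minus_equation_iff[of "rs d"])
    then show ?thesis by blast
  qed
qed

text \<open>Each reflection subtracts an integral multiple of a root of the line. This is the source
  of the crystallographic condition for the restricted roots.\<close>

lemma rs_weyl_line_integral:
  assumes "\<alpha> \<in> ru" "v \<in> weyl (R \<inter> line \<alpha>)" "\<beta> \<in> R"
  shows "\<exists>k::int. rs (v \<beta>) = rs \<beta> + of_int k *\<^sub>R rs \<alpha>"
  using assms(2)
proof (induction rule: weyl_induct)
  case id
  show ?case by (rule exI[of _ 0]) simp
next
  case (step d v)
  then obtain k where k: "rs (v \<beta>) = rs \<beta> + of_int k *\<^sub>R rs \<alpha>" by blast
  have "v \<beta> \<in> R" using step(2) weyl_line_subset weyl_in_R assms(3) by blast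
  then obtain m where m: "2 * (v \<beta> \<bullet> d) / (d \<bullet> d) = of_int m"
    using cartan_int[of d "v \<beta>"] step(1) by (auto simp: Ints_def)
  obtain j :: int where j: "rs d = of_int j *\<^sub>R rs \<alpha>" using rs_line_integral[OF assms(1) step(1)] by blast
  have "rs ((root_refl d \<circ> v) \<beta>) = rs \<beta> + of_int (k - m * j) *\<^sub>R rs \<alpha>"
    by (simp add: root_refl_def m k j algebra_simps)
  then show ?case by blast
qed

text \<open>Proportional restrictions give the same line and hence the same base, of which both
  roots are the only member outside \<open>\<Theta>\<close>.\<close>

lemma ru_unique:
  assumes "\<alpha> \<in> ru" "\<beta> \<in> ru" "rs \<beta> = c *\<^sub>R rs \<alpha>"
  shows "\<beta> = \<alpha>"
proof -
  have "c \<noteq> 0" using assms(3) ruD(4)[OF assms(2)] by auto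
  then have "\<Theta> \<union> {\<beta>} = \<Theta> \<union> {\<alpha>}"
    using line_scale[OF assms(3)] ruD(5)[OF assms(1)] ruD(5)[OF assms(2)] by metis
  then show ?thesis using ruD(3) assms(1,2) by blast
qed

lemma RS_cases:
  assumes "\<gamma> \<in> RS"
  obtains \<alpha> e where "\<alpha> \<in> ru" "e = 1 \<or> e = -1" "\<gamma> = e *\<^sub>R rs \<alpha>"
proof -
  consider \<beta> where "\<beta> \<in> ru" "\<gamma> = rs \<beta>" | \<beta> where "\<beta> \<in> ru" "\<gamma> = - rs \<beta>"
    using assms unfolding RS_def ru_Sigma_pos_def by blast
  then show ?thesis
  proof cases
    case 1
    then show ?thesis using that[of \<beta> 1] by simp
  next
    case 2
    then show ?thesis using that[of \<beta> "-1"] by simp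
  qed
qed

lemma RS_in_aa: "\<gamma> \<in> RS \<Longrightarrow> \<gamma> \<in> aa \<Theta>"
  using RS_cases subspace_scale[OF subspace_aa res_in_aa] by metis

lemma root_refl_RS:
  assumes "\<gamma> \<in> RS"
  obtains \<alpha> where "\<alpha> \<in> ru" "root_refl \<gamma> = root_refl (rs \<alpha>)"
  using RS_cases[OF assms] that by (metis root_refl_minus scaleR_minus1_left scaleR_one)

text \<open>The reflection in a restricted root acts on the others as some
  \<open>\<sigma> \<alpha>\<close>, which gives closure by \<open>W'_RS\<close>; that proportional
  roots agree up to sign comes from \<open>ru_unique\<close>.\<close>

lemma RS_root_system: "root_system RS"
proof -
  have fin: "finite RS"
    using finite_P unfolding RS_def ru_Sigma_pos_def ru_Delta_pos_def by auto
  have zero: "0 \<notin> RS"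
  proof
    assume "0 \<in> RS"
    then obtain \<alpha> e where "\<alpha> \<in> ru" "e = 1 \<or> e = -1" "0 = e *\<^sub>R rs \<alpha>" by (rule RS_cases)
    then show False using ruD(4)[of \<alpha>] by auto
  qed
  have refl: "root_refl \<gamma> \<delta> \<in> RS" if \<gamma>\<delta>: "\<gamma> \<in> RS" "\<delta> \<in> RS" for \<gamma> \<delta>
  proof -
    obtain \<alpha> where \<alpha>: "\<alpha> \<in> ru" "root_refl \<gamma> = root_refl (rs \<alpha>)" using \<gamma>\<delta>(1) root_refl_RS by blast
    then have "root_refl \<gamma> \<delta> = \<sigma> \<alpha> \<delta>" using sigma_on_aa RS_in_aa \<gamma>\<delta>(2) by simp
    then show ?thesis using W'_RS[OF sigma_in_W'[OF \<alpha>(1)] \<gamma>\<delta>(2)] by simp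
  qed
  have image: "root_refl \<gamma> ` RS = RS" if "\<gamma> \<in> RS" for \<gamma>
  proof
    show "RS \<subseteq> root_refl \<gamma> ` RS"
      using refl[OF that] by (metis image_eqI root_refl_root_refl subsetI)
  qed (use refl that in blast)
  have int: "2 * (\<delta> \<bullet> \<gamma>) / (\<gamma> \<bullet> \<gamma>) \<in> \<int>" if "\<gamma> \<in> RS" "\<delta> \<in> RS" for \<gamma> \<delta>
  proof -
    obtain \<alpha> e where \<alpha>: "\<alpha> \<in> ru" "e = 1 \<or> e = -1" "\<gamma> = e *\<^sub>R rs \<alpha>" using \<open>\<gamma> \<in> RS\<close> by (rule RS_cases)
    obtain \<beta> f where \<beta>: "\<beta> \<in> ru" "f = 1 \<or> f = -1" "\<delta> = f *\<^sub>R rs \<beta>" using \<open>\<delta> \<in> RS\<close> by (rule RS_cases)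
    obtain k :: int where k: "rs (\<sigma> \<alpha> \<beta>) = rs \<beta> + of_int k *\<^sub>R rs \<alpha>"
      using rs_weyl_line_integral[OF \<alpha>(1) sigma_weyl ruD(2)[OF \<beta>(1)]] by blast
    have "rs (\<sigma> \<alpha> \<beta>) = root_refl (rs \<alpha>) (rs \<beta>)"
      using rs_W'[OF sigma_in_W'[OF \<alpha>(1)]] sigma_on_aa[OF \<alpha>(1) res_in_aa] by simp
    \<comment> \<open>The integral expression for the restriction of
      \<open>\<sigma> \<alpha> \<beta>\<close> is compared with the reflection formula.\<close>
    then have "(2 * (rs \<beta> \<bullet> rs \<alpha>) / (rs \<alpha> \<bullet> rs \<alpha>)) *\<^sub>R rs \<alpha> = of_int (- k) *\<^sub>R rs \<alpha>"
      unfolding k root_refl_def by (simp add: algebra_simps eq_neg_iff_add_eq_0)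
    then have "2 * (rs \<beta> \<bullet> rs \<alpha>) / (rs \<alpha> \<bullet> rs \<alpha>) = of_int (- k)"
      using ruD(4)[OF \<alpha>(1)] by (simp only: scaleR_cancel_right) blast
    moreover have "2 * (\<delta> \<bullet> \<gamma>) / (\<gamma> \<bullet> \<gamma>) = (e * f) * (2 * (rs \<beta> \<bullet> rs \<alpha>) / (rs \<alpha> \<bullet> rs \<alpha>))"
      using \<alpha>(2) \<beta>(2) unfolding \<alpha>(3) \<beta>(3) by auto
    moreover have "e * f \<in> \<int>" using \<alpha>(2) \<beta>(2) by auto
    ultimately show ?thesis by (metis Ints_mult Ints_of_int)
  qed
  have mult: "c = 1 \<or> c = -1" if "\<gamma> \<in> RS" "c *\<^sub>R \<gamma> \<in> RS" for \<gamma> c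
  proof -
    obtain \<alpha> e where \<alpha>: "\<alpha> \<in> ru" "e = 1 \<or> e = -1" "\<gamma> = e *\<^sub>R rs \<alpha>" using \<open>\<gamma> \<in> RS\<close> by (rule RS_cases)
    obtain \<beta> f where \<beta>: "\<beta> \<in> ru" "f = 1 \<or> f = -1" "c *\<^sub>R \<gamma> = f *\<^sub>R rs \<beta>" using \<open>c *\<^sub>R \<gamma> \<in> RS\<close> by (rule RS_cases)
    have "rs \<beta> = f *\<^sub>R (f *\<^sub>R rs \<beta>)" using \<beta>(2) by auto
    also have "\<dots> = (f * c * e) *\<^sub>R rs \<alpha>" unfolding \<beta>(3)[symmetric] \<alpha>(3) by simp
    finally have eq: "rs \<beta> = (f * c * e) *\<^sub>R rs \<alpha>" .
    then have "\<beta> = \<alpha>" using ru_unique \<alpha>(1) \<beta>(1) by blast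
    then have "(f * c * e) *\<^sub>R rs \<alpha> = 1 *\<^sub>R rs \<alpha>" using eq by simp
    then have "f * c * e = 1" using ruD(4)[OF \<alpha>(1)] by (simp only: scaleR_cancel_right) blast
    then show ?thesis using \<alpha>(2) \<beta>(2) by auto
  qed
  show ?thesis
    unfolding root_system_def using fin zero image int mult by blast
qed

lemma Sp_omega: "\<gamma> \<in> Sp \<Longrightarrow> \<gamma> \<bullet> \<omega> > 0"
  using rs_omega_pos ruD(1,4) by (auto simp: ru_Sigma_pos_def)

text \<open>This makes the whole Coxeter theory available for the restricted roots, with base
  \<open>u_Pi\<close>.\<close>

sublocale sg: based_root_system RS Sp \<omega>
proof
  show "root_system RS" by (rule RS_root_system)
  show "a \<bullet> \<omega> \<noteq> 0" if "a \<in> RS" for a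
    using that Sp_omega unfolding RS_def by fastforce
  show "Sp = {a \<in> RS. 0 < a \<bullet> \<omega>}"
    using Sp_omega unfolding RS_def by fastforce
qed

text \<open>\<open>W'\<close> permutes \<open>\<Theta>\<close> but need not fix it, so restriction to \<open>\<aa>\<^sub>\<Theta>\<close> is extended by the identity on the
  span of \<open>\<Theta>\<close> in order to land in the Weyl group of the restricted roots.\<close>

definition phi :: "('a \<Rightarrow> 'a) \<Rightarrow> 'a \<Rightarrow> 'a" where
  "phi w v = w (rs v) + (v - rs v)"

lemma phi_aa: "v \<in> aa \<Theta> \<Longrightarrow> phi w v = w v"
  by (simp add: phi_def res_of_aa)

lemma phi_id: "phi id = id"
  by (rule ext) (simp add: phi_def)

lemma phi_comp:
  assumes "w \<in> W'"
  shows "phi (v \<circ> w) = phi v \<circ> phi w"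
proof (rule ext)
  fix x
  have "rs (phi w x) = w (rs x)"
    using rs_W'[OF assms, of "rs x"] by (simp add: phi_def)
  then show "phi (v \<circ> w) x = (phi v \<circ> phi w) x" by (simp add: phi_def[of "v \<circ> w"] phi_def[of v]) (simp add: phi_def)
qed

text \<open>Both maps are the identity on \<open>span \<Theta>\<close>, to which
  \<open>rs \<alpha>\<close> is orthogonal.\<close>

lemma phi_sigma:
  assumes "\<alpha> \<in> ru"
  shows "phi (\<sigma> \<alpha>) = root_refl (rs \<alpha>)"
proof (rule ext)
  fix v
  have "rs v \<bullet> rs \<alpha> = v \<bullet> rs \<alpha>" by (rule res_inner[OF res_in_aa])
  then show "phi (\<sigma> \<alpha>) v = root_refl (rs \<alpha>) v"
    using sigma_on_aa[OF assms res_in_aa] by (simp add: phi_def root_refl_def)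
qed

lemma phi_in_weyl: "w \<in> W' \<Longrightarrow> phi w \<in> weyl RS"
proof (induction rule: W'_induct)
  case id
  show ?case using id_in_weyl by (simp only: phi_id)
next
  case (sigma \<alpha>)
  then have "rs \<alpha> \<in> RS" by (simp add: RS_def ru_Sigma_pos_def)
  then show ?case using sigma by (simp only: phi_sigma root_refl_in_weyl)
next
  case (comp v w)
  then show ?case by (simp only: phi_comp weyl_comp)
qed

text \<open>Roots outside \<open>span \<Theta>\<close> keep their sign together with their
  restriction; those inside keep it because \<open>w\<close> permutes the base
  \<open>\<Theta>\<close>.\<close>

lemma phi_eq_id:
  assumes "w \<in> W'" "phi w = id"
  shows "w = id"
proof (rule eq_id_if_pos)
  show W: "w \<in> W" using assms(1) W'_subset by blast
  fix \<beta> assume \<beta>: "\<beta> \<in> P"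
  have R: "\<beta> \<in> R" "w \<beta> \<in> R" using \<beta> W P_subset weyl_in_R by blast+
  have rs: "rs (w \<beta>) = rs \<beta>"
    using rs_W'[OF assms(1)] phi_aa[OF res_in_aa, of w \<beta>] assms(2) by simp
  show "w \<beta> \<in> P"
  proof (cases "rs \<beta> = 0")
    case True
    then have "\<beta> \<in> P \<inter> span \<Theta>" using \<beta> by (simp add: res_eq_0_iff)
    from pos_on_subsystem[OF subspace_span W _ this] show ?thesis
      using W'_Theta[OF assms(1)] Theta_subset_P unfolding th_simple by blast
  next
    case False
    then show ?thesis using rs pos_iff_rs_omega R \<beta> by metis
  qed
qed

lemma inv_in_W': "w \<in> W' \<Longrightarrow> inv_fun w \<in> W'"
proof (induction rule: W'_induct)
  case id
  have "inv_fun id = (id :: 'a \<Rightarrow> 'a)" by (rule inv_id)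
  then show ?case using id_in_W' by (simp only:)
next
  case (sigma \<alpha>)
  have "inv_fun (\<sigma> \<alpha>) = \<sigma> \<alpha>"
    using ruD(6)[OF sigma] inv_unique_comp by blast
  then show ?case using sigma_in_W'[OF sigma] by (simp only:)
next
  case (comp v w)
  have "inv_fun (v \<circ> w) = inv_fun w \<circ> inv_fun v"
    using comp(3,4) weyl_bij by (intro o_inv_distrib) blast+
  then show ?case using comp comp_in_W' by metis
qed

lemma phi_inj: "inj_on phi W'"
proof (rule inj_onI)
  fix v w assume vw: "v \<in> W'" "w \<in> W'" "phi v = phi w"
  have vW: "v \<in> W" using vw(1) W'_subset by blast
  have "phi (inv_fun v \<circ> w) = phi (inv_fun v) \<circ> phi v" using vw phi_comp by metis
  also have "\<dots> = phi (inv_fun v \<circ> v)" using vw(1) phi_comp by metis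
  also have "\<dots> = id" unfolding weyl_inv_comp(1)[OF vW] phi_id ..
  finally have "inv_fun v \<circ> w = id" using phi_eq_id comp_in_W' inv_in_W' vw by blast
  then show "v = w" using weyl_inv_comp(2)[OF vW] by (metis comp_assoc comp_id id_comp)
qed

lemma phi_image: "phi ` W' = weyl RS"
proof
  show "phi ` W' \<subseteq> weyl RS" using phi_in_weyl by blast
  show "weyl RS \<subseteq> phi ` W'"
  proof
    fix u assume "u \<in> weyl RS"
    then show "u \<in> phi ` W'"
    proof (induction rule: weyl_induct)
      case id
      show ?case using phi_id id_in_W' by (metis imageI)
    next
      case (step \<gamma> u)
      then obtain w where w: "w \<in> W'" "u = phi w" by blast
      obtain \<alpha> where \<alpha>: "\<alpha> \<in> ru" "root_refl \<gamma> = root_refl (rs \<alpha>)"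
        using root_refl_RS[OF step(1)] by blast
      have "root_refl \<gamma> \<circ> u = phi (\<sigma> \<alpha> \<circ> w)"
        unfolding phi_comp[OF w(1)] phi_sigma[OF \<alpha>(1)] \<alpha>(2) w(2) ..
      then show ?case using comp_in_W'[OF sigma_in_W'[OF \<alpha>(1)] w(1)] by blast
    qed
  qed
qed

lemma group_W': "group (W_prime R P \<Theta>)"
proof -
  interpret group "weyl_group R" by (rule group_weyl_group)
  show ?thesis unfolding W_prime_def
    by (intro subgroup_imp_group generate_is_subgroup)
      (auto simp: carrier_weyl_group intro: sigma_in_W)
qed

lemma phi_iso: "phi \<in> iso (W_prime R P \<Theta>) (weyl_group RS)"
proof (rule isoI)
  show "bij_betw phi W' (carrier (weyl_group RS))"
    using phi_inj phi_image by (simp add: bij_betw_def carrier_weyl_group)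
  show "phi \<in> hom (W_prime R P \<Theta>) (weyl_group RS)"
  proof (rule homI)
    fix v w assume vw: "v \<in> W'" "w \<in> W'"
    have "v \<otimes>\<^bsub>W_prime R P \<Theta>\<^esub> w = v \<circ> w"
      using mult_weyl_group[OF weyl_bij[OF W'_subset[OF vw(1)]] weyl_bij[OF W'_subset[OF vw(2)]]]
      by (simp add: W_prime_def)
    moreover have "phi v \<otimes>\<^bsub>weyl_group RS\<^esub> phi w = phi v \<circ> phi w"
      using vw phi_in_weyl weyl_bij mult_weyl_group by blast
    ultimately show "phi (v \<otimes>\<^bsub>W_prime R P \<Theta>\<^esub> w) = phi v \<otimes>\<^bsub>weyl_group RS\<^esub> phi w"
      using phi_comp[OF vw(2)] by metis
  qed (use phi_in_weyl in \<open>auto simp: carrier_weyl_group\<close>)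
qed

lemma phi_S_Theta: "phi ` S_Theta R P \<Theta> = root_refl ` simple_roots Sp"
proof -
  have "phi ` S_Theta R P \<Theta> = {phi (\<sigma> \<alpha>) | \<alpha>. \<alpha> \<in> ru \<and> rs \<alpha> \<in> simple_roots Sp}"
    unfolding S_Theta_def u_Pi_def by blast
  also have "\<dots> = {root_refl (rs \<alpha>) | \<alpha>. \<alpha> \<in> ru \<and> rs \<alpha> \<in> simple_roots Sp}"
    using phi_sigma by (metis (no_types, lifting))
  also have "\<dots> = root_refl ` simple_roots Sp"
    using sg.B_subset unfolding ru_Sigma_pos_def by blast
  finally show ?thesis .
qed

section \<open>Comparison of the two Bruhat orders\<close>

abbreviation "bleT \<equiv> bruhat_le (W_prime R P \<Theta>) (S_Theta R P \<Theta>)"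

lemma bleT_iff: "x \<in> W' \<Longrightarrow> y \<in> W' \<Longrightarrow> bleT x y \<longleftrightarrow> sg.ble (phi x) (phi y)"
proof -
  assume xy: "x \<in> W'" "y \<in> W'"
  have "S_Theta R P \<Theta> \<subseteq> W'" unfolding S_Theta_def using sigma_in_W' by blast
  from bruhat_le_iso[OF group_W' group_weyl_group phi_iso this xy]
  show ?thesis unfolding phi_S_Theta ..
qed

text \<open>It suffices to look at the base \<open>\<Theta> \<union> {\<alpha>}\<close>:
  \<open>w\<close> permutes \<open>\<Theta>\<close>, and the sign of \<open>w \<alpha>\<close> is
  that of its restriction.\<close>

lemma pos_on_line:
  assumes "\<alpha> \<in> ru" "w \<in> W'" "phi w (rs \<alpha>) \<in> Sp" "a \<in> P \<inter> line \<alpha>"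
  shows "w a \<in> P"
proof -
  have W: "w \<in> W" using assms(2) W'_subset by blast
  have rs: "rs (w \<alpha>) \<in> Sp" using assms(3) phi_aa[OF res_in_aa] rs_W'[OF assms(2)] by metis
  then have "rs (w \<alpha>) \<bullet> \<omega> > 0" by (rule Sp_omega)
  then have "w \<alpha> \<in> P" using pos_iff_rs_omega[OF weyl_in_R[OF W ruD(2)[OF assms(1)]]] by fastforce
  then show ?thesis
    by (intro pos_on_subsystem[OF subspace_line W _ assms(4)])
      (use ruD(5)[OF assms(1)] W'_Theta[OF assms(2)] Theta_subset_P in auto)
qed

lemma bleT_imp_ble:
  assumes "x \<in> W'" "y \<in> W'" "bleT x y"
  shows "ble x y"
proof -
  have "sg.ble (phi x) (phi y)" using assms bleT_iff by blast
  \<comment> \<open>The chain runs in the Weyl group of the restricted roots, so a preimage in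
    \<open>W'\<close> of its current element is carried along.\<close>
  then have "\<exists>y'\<in>W'. phi y' = phi y \<and> ble x y'"
    unfolding bruhat_le_def[of "weyl_group RS"]
  proof (induction rule: rtranclp_induct)
    case base
    then show ?case using assms(1) by auto
  next
    case (step u v)
    then obtain y' where y': "y' \<in> W'" "phi y' = u" "ble x y'" by blast
    obtain \<gamma> where \<gamma>: "\<gamma> \<in> Sp" "v = u \<circ> root_refl \<gamma>" "u \<gamma> \<in> Sp"
      using step(2) unfolding sg.bruhat_step_iff by blast
    then obtain \<alpha> where \<alpha>: "\<alpha> \<in> ru" "\<gamma> = rs \<alpha>" by (auto simp: ru_Sigma_pos_def)
    have "phi (y' \<circ> \<sigma> \<alpha>) = v"
      using phi_comp[OF sigma_in_W'[OF \<alpha>(1)]] phi_sigma[OF \<alpha>(1)] y'(2) \<gamma>(2) \<alpha>(2) by metis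
    moreover have "ble y' (y' \<circ> \<sigma> \<alpha>)"
      using \<gamma>(3) y'(2) \<alpha>(2)
      by (intro ble_subsystem[OF subspace_line W'_subset[OF y'(1)] _ sigma_weyl] pos_on_line[OF \<alpha>(1) y'(1)]) auto
    ultimately show ?case
      using y'(3) ble_trans comp_in_W'[OF y'(1) sigma_in_W'[OF \<alpha>(1)]] by blast
  qed
  then show ?thesis using phi_inj assms(2) by (metis inj_on_def)
qed

text \<open>Seminormality only provides a simple root with the right restriction. Being
  indecomposable in \<open>P\<close>, it belongs to the base of the line, whose one member outside
  \<open>\<Theta>\<close> is the useful reduced root.\<close>

lemma seminormal_simple:
  assumes "seminormal R P \<Theta>" "\<gamma> \<in> simple_roots Sp"
  obtains \<alpha> where "\<alpha> \<in> ru" "\<alpha> \<in> B" "\<gamma> = rs \<alpha>"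
proof -
  obtain \<Psi> where "\<Psi> \<subseteq> B" "u_Pi R P \<Theta> = rs ` (\<Psi> - \<Theta>)"
    using assms(1) unfolding seminormal_def by blast
  then obtain \<beta> where \<beta>: "\<beta> \<in> B" "\<beta> \<notin> \<Theta>" "\<gamma> = rs \<beta>"
    using assms(2) unfolding u_Pi_def by blast
  obtain \<alpha> where \<alpha>: "\<alpha> \<in> ru" "\<gamma> = rs \<alpha>"
    using assms(2) sg.B_subset unfolding ru_Sigma_pos_def by blast
  have "\<beta> \<in> line \<alpha>" using line_cong[of \<alpha> \<beta>] \<alpha>(2) \<beta>(3) self_in_line by metis
  then have "\<beta> \<in> \<Theta> \<union> {\<alpha>}" using simple_in_subsystem[OF \<beta>(1)] ruD(5)[OF \<alpha>(1)] by metis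
  then have "\<beta> = \<alpha>" using \<beta>(2) by blast
  then show ?thesis using that \<alpha> \<beta>(1) by blast
qed

lemma ble_imp_sg_ble:
  assumes "seminormal R P \<Theta>" "x \<in> W'" "y \<in> W'" "ble x y"
  shows "sg.ble (phi x) (phi y)"
  using assms(2-)
proof (induction "sg.len (phi y)" arbitrary: x y rule: less_induct)
  case less
  show ?case
  proof (cases "phi y = id")
    case True
    then have "y = id" using phi_eq_id less.prems by blast
    then have "len x \<le> len id" using ble_len less.prems(3) by blast
    then have "x = id" using len_eq_0[OF W'_subset[OF less.prems(1)]] by (simp only: len_id le_zero_eq)
    then show ?thesis using \<open>y = id\<close> sg.ble_refl by (simp only:)
  next
    case False
    have py: "phi y \<in> weyl RS" and px: "phi x \<in> weyl RS" using phi_in_weyl less.prems by blast+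
    obtain \<gamma> where \<gamma>: "\<gamma> \<in> simple_roots Sp" "phi y \<gamma> \<notin> Sp"
      using sg.ex_simple_neg[OF py False] by blast
    then have \<gamma>P: "\<gamma> \<in> Sp" "\<gamma> \<in> RS" using sg.B_subset sg.P_subset by blast+
    obtain \<alpha> where \<alpha>: "\<alpha> \<in> ru" "\<alpha> \<in> B" "\<gamma> = rs \<alpha>"
      using seminormal_simple[OF assms(1) \<gamma>(1)] by blast
    note \<sigma>W' = sigma_in_W'[OF \<alpha>(1)]
    have phi_comp_sigma: "phi (w \<circ> \<sigma> \<alpha>) = phi w \<circ> root_refl \<gamma>" for w
      using phi_comp[OF \<sigma>W'] phi_sigma[OF \<alpha>(1)] \<alpha>(3) by metis
    have sq: "w \<circ> \<sigma> \<alpha> \<circ> \<sigma> \<alpha> = w" for w :: "'a \<Rightarrow> 'a"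
      using ruD(6)[OF \<alpha>(1)] by (metis comp_assoc comp_id)
    have flip: "phi (w \<circ> \<sigma> \<alpha>) \<gamma> \<in> Sp" if w: "w \<in> W'" "phi w \<gamma> \<notin> Sp" for w
    proof -
      have "phi w \<gamma> \<in> RS" using sg.weyl_in_R phi_in_weyl w(1) \<gamma>P(2) by blast
      then have "- phi w \<gamma> \<in> Sp" using w(2) sg.notin_P_iff by blast
      then show ?thesis using sg.weyl_uminus[OF phi_in_weyl[OF w(1)]] by (simp add: phi_comp_sigma)
    qed
    define y' where "y' = y \<circ> \<sigma> \<alpha>"
    have y': "y' \<in> W'" "phi y' \<gamma> \<in> Sp" "y = y' \<circ> \<sigma> \<alpha>"
      unfolding y'_def using comp_in_W'[OF less.prems(2) \<sigma>W'] flip[OF less.prems(2) \<gamma>(2)] sq by auto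
    \<comment> \<open>The sign at \<open>\<gamma>\<close> tells which of \<open>x\<close> and
      \<open>x \<circ> \<sigma> \<alpha>\<close> keeps the positive roots of the line
      positive.\<close>
    have "\<exists>x' u. x' \<in> W' \<and> phi x' \<gamma> \<in> Sp \<and> x = x' \<circ> u \<and> (u = id \<or> u = \<sigma> \<alpha>)"
    proof (cases "phi x \<gamma> \<in> Sp")
      case True
      then show ?thesis using less.prems(1) by (intro exI[of _ x] exI[of _ id]) simp
    next
      case False
      then show ?thesis
        using comp_in_W'[OF less.prems(1) \<sigma>W'] flip[OF less.prems(1)] sq
        by (intro exI[of _ "x \<circ> \<sigma> \<alpha>"] exI[of _ "\<sigma> \<alpha>"]) metis
    qed
    then obtain x' u where x': "x' \<in> W'" "phi x' \<gamma> \<in> Sp" "x = x' \<circ> u" and u: "u = id \<or> u = \<sigma> \<alpha>"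
      by blast
    have uW: "u \<in> weyl (R \<inter> line \<alpha>)" using u sigma_weyl id_in_weyl by metis
    have "simple_roots (P \<inter> line \<alpha>) \<subseteq> B" using ruD(5)[OF \<alpha>(1)] \<alpha>(2) Theta_simple by blast
    then have "ble x' y'"
      using pos_on_line[OF \<alpha>(1) x'(1)] pos_on_line[OF \<alpha>(1) y'(1)] x'(2) y'(2) \<alpha>(3)
        less.prems(3) x'(3) y'(3)
      by (intro ble_projection[OF subspace_line _ W'_subset[OF x'(1)] _ W'_subset[OF y'(1)] _ uW sigma_weyl]) metis+
    moreover have "sg.len (phi y') < sg.len (phi y)"
      unfolding y'_def phi_comp_sigma by (rule sg.len_decreases[OF py \<gamma>P(1) \<gamma>(2)])
    ultimately have ble': "sg.ble (phi x') (phi y')" using less.hyps x'(1) y'(1) by blast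
    have px': "phi x' \<in> weyl RS" using x'(1) phi_in_weyl by blast
    \<comment> \<open>Lifting compares the larger members of the two pairs: on the right this is
      \<open>phi y\<close>, and on the left \<open>phi x\<close> lies below it, being one of its
      pair.\<close>
    have "sg.ble (sg.high \<gamma> (phi x')) (sg.high \<gamma> (phi y'))"
      by (rule sg.lifting(2)[OF ble' px' \<gamma>(1)])
    moreover have "sg.high \<gamma> (phi y') = phi y"
      using y'(2) unfolding sg.high_def y'(3) phi_comp_sigma by (simp only: if_True)
    moreover have "sg.ble (phi x) (sg.high \<gamma> (phi x'))"
    proof -
      have "phi x = phi x' \<or> phi x = phi x' \<circ> root_refl \<gamma>"
        using u x'(3) phi_comp_sigma by (metis comp_id)
      then show ?thesis using sg.ble_low_high(2,4)[OF px' \<gamma>P(1)] by metis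
    qed
    ultimately show ?thesis using sg.ble_trans by metis
  qed
qed

end

theorem theorem3p4p5:
  fixes \<Delta> P \<Theta> :: "'a::euclidean_space set"
  assumes "root_system \<Delta>" and "positive_system \<Delta> P"
    and "\<Theta> \<subset> simple_roots P" and "seminormal \<Delta> P \<Theta>"
  shows "\<forall>x\<in>carrier (W_prime \<Delta> P \<Theta>). \<forall>y\<in>carrier (W_prime \<Delta> P \<Theta>).
           bruhat_le (weyl_group \<Delta>) (root_refl ` simple_roots P) x y
           \<longleftrightarrow> bruhat_le (W_prime \<Delta> P \<Theta>) (S_Theta \<Delta> P \<Theta>) x y"
proof -
  obtain \<xi> where "\<forall>\<alpha>\<in>\<Delta>. \<alpha> \<bullet> \<xi> \<noteq> 0" "P = {\<alpha> \<in> \<Delta>. \<alpha> \<bullet> \<xi> > 0}"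
    using assms(2) unfolding positive_system_def by blast
  then interpret parabolic_root_system \<Delta> P \<xi> \<Theta>
    using assms(1,3) by unfold_locales blast+
  show ?thesis using ble_imp_sg_ble[OF assms(4)] bleT_imp_ble bleT_iff by blast
qed

end
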